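(* Let $\mathcal W\subset\mathbb R^d$ be a nonempty compact convex set, $B:=\sup_{w\in\mathcal W}\|w\|_\infty$ and $\mathcal D=\{x\in\mathbb R^d:\|x\|_\infty\le B\}$. Let $G>0$ and let the losses $f_t$ be differentiable, $H$-strongly convex in $L_2$ norm on $\mathcal D$, with $\|\nabla f_t(x)\|_\infty\le G$ for all $x\in\mathcal D$. Let $\mathcal A$ be the algorithm of the coordinate-wise FLH-OGD construction (Corollary 1) on $\mathcal D$ with $G_\infty=2G$. Consider the scheme: at round $t$ obtain $x_t\in\mathcal D$ from $\mathcal A$, play $\hat x_t=\Pi_{\mathcal W}(x_t)\in\arg\min_{y\in\mathcal W}\|x_t-y\|_1$, observe $f_t$, and feed $\mathcal A$ the surrogate loss $\ell_t(x)=f_t(x)+G\,S(x)$ with $S(x)=\|x-\Pi_{\mathcal W}(x)\|_1$ (using its subgradients). Then for every $C_n\ge 0$ and every comparator sequence $w_1,\dots,w_n\in\mathcal W$ with $\sum_{t=2}^n\|w_t-w_{t-1}\|_1\le C_n$, $$\sum_{t=1}^n f_t(\hat x_t)-f_t(w_t)=\tilde O\big(d^{1/3}n^{1/3}C_n^{2/3}\vee d\big),$$ where $\tilde O$ hides constants and factors depending on $\log n$, $H$, $G$, $B$.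
   Context: Coordinate-wise FLH-OGD (Corollary 1) for $H$-strongly convex losses $g_t$ on $\mathcal D$ with $\|\nabla g_t\|_\infty\le G_\infty$ (gradients may be subgradients): run $d$ independent instances of univariate FLH-OGD with decision set $[-B,B]$ and learning rate $\zeta=1/(2(2B+G_\infty/H)^2)$; instance $i$ outputs $x_t[i]$ and receives the squared loss $x\mapsto\big(x-(x_t[i]-\nabla g_t(x_t)[i]/H)\big)^2$. Univariate FLH-OGD on squared losses $x\mapsto(y_t-x)^2$: for each $j$ a base learner started at time $j$ runs projected OGD on $[-B,B]$ from a fixed start point with $x^{(j)}_{t+1}=\Pi(x^{(j)}_t-\frac{1}{2\tau}2(x^{(j)}_t-y_t))$, $\tau=t-j+1$; the FLH meta-algorithm keeps weights $v_t$, $v_1=(1)$, predicts $x_t=\sum_{j\le t}v^{(j)}_tx^{(j)}_t$, updates $\hat v^{(i)}_{t+1}\propto v^{(i)}_te^{-\zeta(y_t-x^{(i)}_t)^2}$ ($i\le t$, normalized), $v^{(t+1)}_{t+1}=1/(t+1)$, $v^{(i)}_{t+1}=(1-\frac1{t+1})\hat v^{(i)}_{t+1}$. $a\vee b=\max\{a,b\}$. *)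

theory Defs
  imports "HOL-Analysis.Analysis"
begin

definition vecs :: "nat \<Rightarrow> (nat \<Rightarrow> real) set" where
  "vecs d = {x. \<forall>i\<ge>d. x i = 0}"

definition inner_d :: "nat \<Rightarrow> (nat \<Rightarrow> real) \<Rightarrow> (nat \<Rightarrow> real) \<Rightarrow> real" where
  "inner_d d x y = (\<Sum>i<d. x i * y i)"

definition norm1_d :: "nat \<Rightarrow> (nat \<Rightarrow> real) \<Rightarrow> real" where
  "norm1_d d x = (\<Sum>i<d. \<bar>x i\<bar>)"

definition norm2_d :: "nat \<Rightarrow> (nat \<Rightarrow> real) \<Rightarrow> real" where
  "norm2_d d x = sqrt (\<Sum>i<d. (x i)\<^sup>2)"

definition norminf_d :: "nat \<Rightarrow> (nat \<Rightarrow> real) \<Rightarrow> real" where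
  "norminf_d d x = Max (insert 0 ((\<lambda>i. \<bar>x i\<bar>) ` {..<d}))"

definition convex_d :: "(nat \<Rightarrow> real) set \<Rightarrow> bool" where
  "convex_d W = (\<forall>x\<in>W. \<forall>y\<in>W. \<forall>u::real. 0 \<le> u \<and> u \<le> 1 \<longrightarrow>
                   (\<lambda>i. (1 - u) * x i + u * y i) \<in> W)"

definition box_d :: "nat \<Rightarrow> real \<Rightarrow> (nat \<Rightarrow> real) set" where
  "box_d d B = {x \<in> vecs d. norminf_d d x \<le> B}"

definition has_grad_within :: "nat \<Rightarrow> ((nat \<Rightarrow> real) \<Rightarrow> real) \<Rightarrow> (nat \<Rightarrow> real)
      \<Rightarrow> (nat \<Rightarrow> real) \<Rightarrow> (nat \<Rightarrow> real) set \<Rightarrow> bool" where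
  "has_grad_within d f g x D =
     (g \<in> vecs d \<and> (\<forall>e>0. \<exists>\<delta>>0. \<forall>y\<in>D. norm2_d d (\<lambda>i. y i - x i) < \<delta> \<longrightarrow>
        \<bar>f y - f x - inner_d d g (\<lambda>i. y i - x i)\<bar> \<le> e * norm2_d d (\<lambda>i. y i - x i)))"

definition strongly_convex_on_d :: "nat \<Rightarrow> real \<Rightarrow> (nat \<Rightarrow> real) set
      \<Rightarrow> ((nat \<Rightarrow> real) \<Rightarrow> real) \<Rightarrow> ((nat \<Rightarrow> real) \<Rightarrow> (nat \<Rightarrow> real)) \<Rightarrow> bool" where
  "strongly_convex_on_d d H D f Df =
     (\<forall>x\<in>D. \<forall>y\<in>D. f y \<ge> f x + inner_d d (Df x) (\<lambda>i. y i - x i)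
                         + H / 2 * (norm2_d d (\<lambda>i. y i - x i))\<^sup>2)"

text \<open>S(x) = || x - Pi_W(x) ||_1, the L1 distance from x to W.\<close>
definition dist1_set :: "nat \<Rightarrow> (nat \<Rightarrow> real) set \<Rightarrow> (nat \<Rightarrow> real) \<Rightarrow> real" where
  "dist1_set d W x = (INF y\<in>W. norm1_d d (\<lambda>i. x i - y i))"

section \<open>Univariate FLH-OGD on squared losses (y_t - x)^2 over [-B,B]\<close>

definition clamp :: "real \<Rightarrow> real \<Rightarrow> real" where
  "clamp B x = max (- B) (min B x)"

text \<open>Base learner started at time j (times start at 1), start point s, target
  sequence y. ogd_base s B y j k is its prediction at time j + k.
  Update: x_{t+1} = Pi(x_t - 1/(2 tau) * 2 (x_t - y_t)), tau = t - j + 1 = k + 1.\<close>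
fun ogd_base :: "real \<Rightarrow> real \<Rightarrow> (nat \<Rightarrow> real) \<Rightarrow> nat \<Rightarrow> nat \<Rightarrow> real" where
  "ogd_base s B y j 0 = s"
| "ogd_base s B y j (Suc k) =
     (let b = ogd_base s B y j k in
      clamp B (b - 1 / (2 * real (Suc k)) * (2 * (b - y (j + k)))))"

text \<open>FLH weights v_t (index t = time, t >= 1; entries i in {1..t}).\<close>
fun flh_weights :: "real \<Rightarrow> real \<Rightarrow> real \<Rightarrow> (nat \<Rightarrow> real) \<Rightarrow> nat \<Rightarrow> nat \<Rightarrow> real" where
  "flh_weights s B \<zeta> y 0 = (\<lambda>i. 0)"
| "flh_weights s B \<zeta> y (Suc t) =
     (if t = 0 then (\<lambda>i. if i = 1 then 1 else 0)
      else (let v = flh_weights s B \<zeta> y t;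
                L = (\<lambda>k. v k * exp (- \<zeta> * (y t - ogd_base s B y k (t - k))\<^sup>2));
                Z = (\<Sum>k\<in>{1..t}. L k)
            in (\<lambda>i. if i = Suc t then 1 / real (Suc t)
                     else if 1 \<le> i \<and> i \<le> t then (1 - 1 / real (Suc t)) * (L i / Z)
                     else 0)))"

definition flh_pred :: "real \<Rightarrow> real \<Rightarrow> real \<Rightarrow> (nat \<Rightarrow> real) \<Rightarrow> nat \<Rightarrow> real" where
  "flh_pred s B \<zeta> y t = (\<Sum>j\<in>{1..t}. flh_weights s B \<zeta> y t j * ogd_base s B y j (t - j))"

end

theory Submission
  imports Defs
begin

text \<open>The surrogate loss and strong convexity bound the regret of a round by \<open>H / 2\<close> times the sum over
  coordinates of the regrets for the squared losses with targets \<open>y\<close>. So it suffices to bound the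
  dynamic regret of one univariate FLH-OGD instance, whose regret against any constant in \<open>[-B, B]\<close>
  on any interval is at most some \<open>L\<close> of order \<open>log n\<close>.

  Fix \<open>\<epsilon> < B\<close>. It suffices to compare with the minimiser \<open>w\<close> of the squared error plus
  \<open>L / \<epsilon>\<close> times the total variation, with credit for its own penalty. Cut time greedily:
  a bin starting at \<open>a\<close> ends as soon as \<open>w\<close> leaves \<open>[w a - \<epsilon>, w a + \<epsilon>]\<close>. Replacing \<open>w\<close> on a bin by a
  constant \<open>u\<close> (\<open>w a\<close>, or the end of the box that the bin touches) costs a quadratic term of at most
  \<open>4 \<epsilon>\<^sup>2\<close> per round and a linear term; optimality of \<open>w\<close> under dilation of the bin away
  from \<open>u\<close> bounds the latter by the penalty of the bin, exit jump included, minus \<open>(L / \<epsilon>) \<epsilon> = L\<close>.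
  This saving pays for the interval regret \<open>L\<close> of the bin, so that bins need not be counted: the dynamic
  regret against a comparator of total variation \<open>C\<close> is at most \<open>L C / \<epsilon> + 4 n \<epsilon>\<^sup>2 + 2 L\<close>. Taking \<open>\<epsilon>\<close> of
  order \<open>(C / n)\<close> to the power \<open>1/3\<close>, but at least of order \<open>1 / sqrt n\<close>, gives the rate, and Hoelder's
  inequality sums it over the coordinates.\<close>

section \<open>Interval regret of univariate FLH-OGD\<close>

lemma clamp_bound: "B \<ge> 0 \<Longrightarrow> \<bar>clamp B z\<bar> \<le> B"
  by (auto simp: clamp_def)

lemma clamp_nonexpansive: "\<bar>u\<bar> \<le> B \<Longrightarrow> (clamp B z - u)\<^sup>2 \<le> (z - u)\<^sup>2"
  by (auto simp: clamp_def abs_le_square_iff[symmetric])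

lemma ogd_base_bound:
  assumes "\<bar>s\<bar> \<le> B"
  shows "\<bar>ogd_base s B y j k\<bar> \<le> B"
  using assms clamp_bound by (cases k) (auto simp: Let_def)

text \<open>The squared loss is 2-strongly convex, so the step size \<open>1 / (2 * \<tau>)\<close>
  makes \<open>m * (b - u)\<^sup>2\<close>, with \<open>b\<close> the current iterate, a telescoping
  potential; it is kept on the left to carry the induction. Each step leaves an error
  \<open>A\<^sup>2 / \<tau>\<close>, whence the harmonic sum.\<close>

lemma ogd_base_regret:
  fixes u :: real
  assumes "\<bar>s\<bar> \<le> B" "\<bar>u\<bar> \<le> B" and y: "\<And>k. k < m \<Longrightarrow> B + \<bar>y (a + k)\<bar> \<le> A"
  shows "(\<Sum>k<m. (y (a + k) - ogd_base s B y a k)\<^sup>2 - (y (a + k) - u)\<^sup>2)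
           + real m * (ogd_base s B y a m - u)\<^sup>2 \<le> A\<^sup>2 * harm m"
  using y
proof (induction m)
  case 0
  then show ?case by (simp add: harm_def)
next
  case (Suc m)
  define b where "b = ogd_base s B y a m"
  define Y where "Y = y (a + m)"
  define M where "M = real (Suc m)"
  have M: "M > 0" "real m = M - 1" by (auto simp: M_def)
  have "1 / (2 * M) * (2 * (b - Y)) = (b - Y) / M" using M by (simp add: field_simps)
  then have step: "ogd_base s B y a (Suc m) = clamp B (b - (b - Y) / M)"
    by (simp only: b_def Y_def M_def ogd_base.simps Let_def)
  have "(ogd_base s B y a (Suc m) - u)\<^sup>2 \<le> (b - (b - Y) / M - u)\<^sup>2"
    unfolding step using assms(2) by (rule clamp_nonexpansive)
  then have "M * (ogd_base s B y a (Suc m) - u)\<^sup>2 \<le> M * (b - (b - Y) / M - u)\<^sup>2"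
    using M by simp
  also have "\<dots> = M * (b - u)\<^sup>2 - 2 * (b - Y) * (b - u) + (b - Y)\<^sup>2 / M"
    using M by (simp add: field_simps power2_eq_square)
  also have "(b - Y)\<^sup>2 / M \<le> A\<^sup>2 / M"
  proof -
    have "\<bar>b\<bar> \<le> B" unfolding b_def by (rule ogd_base_bound) fact
    then have "\<bar>b - Y\<bar> \<le> A" using Suc.prems[of m] by (simp add: Y_def)
    then have "(b - Y)\<^sup>2 \<le> A\<^sup>2" by (metis abs_ge_zero power2_abs power_mono)
    then show ?thesis using M by (simp add: divide_right_mono)
  qed
  finally have "M * (ogd_base s B y a (Suc m) - u)\<^sup>2
      \<le> M * (b - u)\<^sup>2 - 2 * (b - Y) * (b - u) + A\<^sup>2 / M"
    by (simp del: ogd_base.simps)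
  \<comment> \<open>\<open>(Y - b)\<^sup>2 - (Y - u)\<^sup>2\<close> equals
    \<open>2 * (b - Y) * (b - u) - (b - u)\<^sup>2\<close>: the linear terms cancel and strong
    convexity lowers the coefficient from \<open>M\<close> to \<open>M - 1\<close>.\<close>
  then have "M * (ogd_base s B y a (Suc m) - u)\<^sup>2 + ((Y - b)\<^sup>2 - (Y - u)\<^sup>2)
      \<le> (M - 1) * (b - u)\<^sup>2 + A\<^sup>2 / M"
    by (simp add: algebra_simps power2_eq_square del: ogd_base.simps)
  moreover have "(\<Sum>k<m. (y (a + k) - ogd_base s B y a k)\<^sup>2 - (y (a + k) - u)\<^sup>2)
           + (M - 1) * (b - u)\<^sup>2 \<le> A\<^sup>2 * harm m"
    using Suc.IH Suc.prems unfolding M(2)[symmetric] b_def by simp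
  moreover have "A\<^sup>2 * harm (Suc m) = A\<^sup>2 * harm m + A\<^sup>2 / M"
    by (simp add: harm_Suc M_def field_simps)
  ultimately show ?case
    unfolding M_def[symmetric] sum.lessThan_Suc b_def[symmetric] Y_def[symmetric] by linarith
qed

section \<open>FLH: exponential weights over the base learners\<close>

lemma flh_weights_simplex:
  assumes "t \<ge> 1"
  shows "(\<forall>i\<in>{1..t}. flh_weights s B \<zeta> y t i > 0) \<and> (\<Sum>i\<in>{1..t}. flh_weights s B \<zeta> y t i) = 1"
  using assms
proof (induction t rule: nat_induct_at_least)
  case base
  then show ?case by simp
next
  case (Suc t)
  define L where "L = (\<lambda>k. flh_weights s B \<zeta> y t k * exp (- \<zeta> * (y t - ogd_base s B y k (t - k))\<^sup>2))"
  define Z where "Z = (\<Sum>k\<in>{1..t}. L k)"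
  have L: "L i > 0" if "i \<in> {1..t}" for i using Suc that by (simp add: L_def)
  \<comment> \<open>Positivity is carried through the induction together with the total mass, since
    the normalisation divides by \<open>Z\<close>.\<close>
  then have Z: "Z > 0" unfolding Z_def using Suc by (intro sum_pos) auto
  have W: "flh_weights s B \<zeta> y (Suc t) i = (if i = Suc t then 1 / real (Suc t)
      else if 1 \<le> i \<and> i \<le> t then (1 - 1 / real (Suc t)) * (L i / Z) else 0)" for i
    using Suc.hyps by (simp add: L_def Z_def Let_def)
  have "(\<Sum>i\<in>{1..t}. flh_weights s B \<zeta> y (Suc t) i) = (\<Sum>i\<in>{1..t}. (1 - 1 / real (Suc t)) * (L i / Z))"
    by (intro sum.cong) (auto simp: W simp del: flh_weights.simps)
  also have "\<dots> = 1 - 1 / real (Suc t)"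
    unfolding sum_distrib_left[symmetric] sum_divide_distrib[symmetric] Z_def[symmetric] using Z by simp
  finally have "(\<Sum>i\<in>{1..Suc t}. flh_weights s B \<zeta> y (Suc t) i) = 1"
    by (simp add: W del: flh_weights.simps)
  moreover have "flh_weights s B \<zeta> y (Suc t) i > 0" if "i \<in> {1..Suc t}" for i
    using that L Z Suc.hyps by (auto simp: W simp del: flh_weights.simps intro!: mult_pos_pos divide_pos_pos)
  ultimately show ?case by blast
qed

lemma flh_pred_bound:
  assumes "\<bar>s\<bar> \<le> B" "t \<ge> 1"
  shows "\<bar>flh_pred s B \<zeta> y t\<bar> \<le> B"
proof -
  let ?v = "flh_weights s B \<zeta> y t"
  have v: "\<forall>i\<in>{1..t}. ?v i > 0" "(\<Sum>i\<in>{1..t}. ?v i) = 1"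
    using flh_weights_simplex[OF assms(2)] by auto
  have "\<bar>flh_pred s B \<zeta> y t\<bar> \<le> (\<Sum>j\<in>{1..t}. \<bar>?v j * ogd_base s B y j (t - j)\<bar>)"
    unfolding flh_pred_def by (rule sum_abs)
  also have "\<dots> \<le> (\<Sum>j\<in>{1..t}. ?v j * B)"
    using v ogd_base_bound[OF assms(1)] by (intro sum_mono) (auto simp: abs_mult order.strict_implies_order intro!: mult_mono)
  also have "\<dots> = B" using v(2) by (simp add: sum_distrib_right[symmetric])
  finally show ?thesis .
qed

text \<open>Exp-concavity of the squared loss: the second derivative has the sign of
  \<open>1 - 2 * c * z\<^sup>2\<close>, and the rate \<open>1 / (2 * A\<^sup>2)\<close> is the
  largest one that keeps this nonnegative up to \<open>\<bar>z\<bar> = A\<close>.\<close>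

lemma gaussian_concave:
  fixes A :: real
  assumes "A > 0"
  shows "convex_on {-A..A} (\<lambda>z. - exp (- (1 / (2 * A\<^sup>2)) * z\<^sup>2))"
proof -
  define c where "c = 1 / (2 * A\<^sup>2)"
  have c: "c > 0" using assms by (simp add: c_def)
  have 1: "((\<lambda>z. - exp (- c * z\<^sup>2)) has_real_derivative 2 * c * z * exp (- c * z\<^sup>2)) (at z)" for z
    by (auto intro!: derivative_eq_intros)
  have 2: "((\<lambda>z. 2 * c * z * exp (- c * z\<^sup>2)) has_real_derivative
      2 * c * (1 - 2 * c * z\<^sup>2) * exp (- c * z\<^sup>2)) (at z)" for z
    by (auto intro!: derivative_eq_intros simp: algebra_simps power2_eq_square)
  have 3: "2 * c * (1 - 2 * c * z\<^sup>2) * exp (- c * z\<^sup>2) \<ge> 0" if "z \<in> {-A..A}" for z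
  proof -
    have "z\<^sup>2 \<le> A\<^sup>2" using that by (intro abs_le_square_iff[THEN iffD1]) auto
    then have "2 * c * z\<^sup>2 \<le> 1" using assms by (simp add: c_def)
    then show ?thesis using c by simp
  qed
  show ?thesis unfolding c_def[symmetric]
    by (rule f''_ge0_imp_convex[where f' = "\<lambda>z. 2 * c * z * exp (- c * z\<^sup>2)"
          and f'' = "\<lambda>z. 2 * c * (1 - 2 * c * z\<^sup>2) * exp (- c * z\<^sup>2)"]) (use 1 2 3 in auto)
qed

text \<open>Jensen's inequality for the exp-concave loss. The left side is the normaliser of the
  weight update.\<close>

lemma flh_mixture_loss:
  assumes "\<bar>s\<bar> \<le> B" "t \<ge> 1" "A > 0" "B + \<bar>y t\<bar> \<le> A" and \<zeta>: "\<zeta> = 1 / (2 * A\<^sup>2)"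
  shows "(\<Sum>j\<in>{1..t}. flh_weights s B \<zeta> y t j * exp (- \<zeta> * (y t - ogd_base s B y j (t - j))\<^sup>2))
           \<le> exp (- \<zeta> * (y t - flh_pred s B \<zeta> y t)\<^sup>2)"
proof -
  let ?v = "flh_weights s B \<zeta> y t" and ?b = "\<lambda>j. ogd_base s B y j (t - j)"
  have v: "\<forall>i\<in>{1..t}. ?v i > 0" "(\<Sum>i\<in>{1..t}. ?v i) = 1"
    using flh_weights_simplex[OF assms(2)] by auto
  have "- exp (- \<zeta> * (\<Sum>j\<in>{1..t}. ?v j *\<^sub>R (y t - ?b j))\<^sup>2)
      \<le> (\<Sum>j\<in>{1..t}. ?v j * - exp (- \<zeta> * (y t - ?b j)\<^sup>2))"
  proof (rule convex_on_sum)
    show "convex_on {-A..A} (\<lambda>z. - exp (- \<zeta> * z\<^sup>2))"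
      unfolding \<zeta> using assms(3) by (rule gaussian_concave)
    show "y t - ?b j \<in> {-A..A}" for j
      using ogd_base_bound[OF assms(1), of y j "t - j"] assms(4) by auto
  qed (use v assms(2) in \<open>auto intro: less_imp_le\<close>)
  moreover have "(\<Sum>j\<in>{1..t}. ?v j *\<^sub>R (y t - ?b j)) = y t - flh_pred s B \<zeta> y t"
    using v(2) by (simp add: flh_pred_def right_diff_distrib sum_subtractf sum_distrib_right[symmetric])
  ultimately show ?thesis by (simp add: sum_negf)
qed

text \<open>The potential is the logarithm of \<open>t\<close> times the weight of expert
  \<open>a\<close>. It starts at 0, since every expert enters with weight \<open>1 / a\<close>; the
  factor \<open>t / (t + 1)\<close> of each update cancels against the growth of \<open>t\<close>;
  and the normaliser is at most the exponential of minus \<open>\<zeta>\<close> times the loss of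
  the mixture.\<close>

lemma flh_meta_regret:
  assumes "\<bar>s\<bar> \<le> B" "1 \<le> a" "A > 0" and \<zeta>: "\<zeta> = 1 / (2 * A\<^sup>2)"
    and y: "\<And>t. a \<le> t \<Longrightarrow> t < a + m \<Longrightarrow> B + \<bar>y t\<bar> \<le> A"
  shows "\<zeta> * (\<Sum>t\<in>{a..<a + m}. (y t - flh_pred s B \<zeta> y t)\<^sup>2 - (y t - ogd_base s B y a (t - a))\<^sup>2)
           \<le> ln (flh_weights s B \<zeta> y (a + m) a) + ln (real (a + m))"
  using y
proof (induction m)
  case 0
  obtain a' where a': "a = Suc a'" using assms(2) by (cases a) auto
  have "flh_weights s B \<zeta> y a a = 1 / real a"
    by (simp add: a' Let_def)
  then show ?case using assms(2) by (simp add: ln_div)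
next
  case (Suc m)
  define t where "t = a + m"
  define v where "v = flh_weights s B \<zeta> y t"
  define L where "L = (\<lambda>k. v k * exp (- \<zeta> * (y t - ogd_base s B y k (t - k))\<^sup>2))"
  define Z where "Z = (\<Sum>k\<in>{1..t}. L k)"
  have t: "t \<ge> 1" "a \<in> {1..t}" using assms by (auto simp: t_def)
  have v: "v i > 0" if "i \<in> {1..t}" for i
    using flh_weights_simplex[OF t(1)] that by (simp add: v_def)
  then have Z: "Z > 0" unfolding Z_def L_def using t by (intro sum_pos) auto
  have "flh_weights s B \<zeta> y (Suc t) a = (1 - 1 / real (Suc t)) * (L a / Z)"
    using t by (simp add: L_def Z_def v_def Let_def)
  also have "\<dots> = real t / real (Suc t) * (v a * exp (- \<zeta> * (y t - ogd_base s B y a (t - a))\<^sup>2) / Z)"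
    by (simp add: L_def field_simps)
  finally have W: "ln (flh_weights s B \<zeta> y (Suc t) a) =
      ln (real t) - ln (real (Suc t)) + (ln (v a) - \<zeta> * (y t - ogd_base s B y a (t - a))\<^sup>2 - ln Z)"
    using t v[OF t(2)] Z by (simp add: ln_mult ln_div del: flh_weights.simps)
  have "Z \<le> exp (- \<zeta> * (y t - flh_pred s B \<zeta> y t)\<^sup>2)"
    unfolding Z_def L_def v_def using flh_mixture_loss[where y=y and s=s, OF assms(1) t(1) assms(3) _ \<zeta>] Suc.prems[of t]
    by (simp add: t_def)
  then have "ln Z \<le> - \<zeta> * (y t - flh_pred s B \<zeta> y t)\<^sup>2"
    using Z by (metis exp_gt_zero ln_exp ln_le_cancel_iff)
  moreover have "\<zeta> * (\<Sum>t\<in>{a..<t}. (y t - flh_pred s B \<zeta> y t)\<^sup>2 - (y t - ogd_base s B y a (t - a))\<^sup>2)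
           \<le> ln (v a) + ln (real t)"
    using Suc by (simp add: t_def v_def)
  ultimately have "\<zeta> * ((\<Sum>t\<in>{a..<t}. (y t - flh_pred s B \<zeta> y t)\<^sup>2 - (y t - ogd_base s B y a (t - a))\<^sup>2) +
      ((y t - flh_pred s B \<zeta> y t)\<^sup>2 - (y t - ogd_base s B y a (t - a))\<^sup>2))
           \<le> ln (flh_weights s B \<zeta> y (Suc t) a) + ln (real (Suc t))"
    unfolding W by (simp add: algebra_simps)
  moreover have "a + Suc m = Suc t" "a \<le> t" by (auto simp: t_def)
  ultimately show ?case by (simp add: sum.atLeastLessThan_Suc del: flh_weights.simps)
qed

text \<open>Goes through the base learner started at the left end \<open>a\<close>. Tracking it
  costs \<open>2 * A\<^sup>2 = 1 / \<zeta>\<close> times \<open>ln c\<close>, where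
  \<open>c \<le> 2 * n\<close>, and its own regret against \<open>u\<close> adds one more
  \<open>A\<^sup>2\<close> times the logarithmic factor.\<close>

lemma flh_interval_regret:
  assumes "\<bar>s\<bar> \<le> B" "\<bar>u\<bar> \<le> B" "1 \<le> a" "a < c" "c \<le> Suc n" "A > 0" and \<zeta>: "\<zeta> = 1 / (2 * A\<^sup>2)"
    and y: "\<And>t. t \<in> {1..n} \<Longrightarrow> B + \<bar>y t\<bar> \<le> A"
  shows "(\<Sum>t\<in>{a..<c}. (y t - flh_pred s B \<zeta> y t)\<^sup>2 - (y t - u)\<^sup>2) \<le> 3 * A\<^sup>2 * (1 + ln (real n))"
proof -
  define m where "m = c - a"
  have c: "c = a + m" and m: "1 \<le> m" "m \<le> n" using assms by (auto simp: m_def)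
  have n: "n \<ge> 1" using assms by auto
  let ?b = "\<lambda>t. ogd_base s B y a (t - a)" and ?x = "flh_pred s B \<zeta> y"
  have "\<zeta> * (\<Sum>t\<in>{a..<c}. (y t - ?x t)\<^sup>2 - (y t - ?b t)\<^sup>2)
      \<le> ln (flh_weights s B \<zeta> y c a) + ln (real c)"
    unfolding c by (rule flh_meta_regret) (use assms c in auto)
  also have "ln (flh_weights s B \<zeta> y c a) \<le> 0"
  proof -
    have *: "\<forall>i\<in>{1..c}. flh_weights s B \<zeta> y c i > 0" "(\<Sum>i\<in>{1..c}. flh_weights s B \<zeta> y c i) = 1"
      using flh_weights_simplex[of c] assms by auto
    have "flh_weights s B \<zeta> y c a \<le> (\<Sum>i\<in>{1..c}. flh_weights s B \<zeta> y c i)"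
      by (rule member_le_sum) (use * assms in \<open>auto intro: less_imp_le\<close>)
    then show ?thesis using * assms by simp
  qed
  also have "ln (real c) \<le> ln (2 * real n)" using assms by simp
  also have "\<dots> = ln 2 + ln (real n)" using n by (simp add: ln_mult)
  also have "ln 2 \<le> (1::real)" using ln_le_minus_one[of "2::real"] by simp
  finally have "(\<Sum>t\<in>{a..<c}. (y t - ?x t)\<^sup>2 - (y t - ?b t)\<^sup>2) \<le> 2 * A\<^sup>2 * (1 + ln (real n))"
    using assms(6) by (simp add: \<zeta> field_simps)
  moreover have "(\<Sum>t\<in>{a..<c}. (y t - ?b t)\<^sup>2 - (y t - u)\<^sup>2) \<le> A\<^sup>2 * (1 + ln (real n))"
  proof -
    have "(\<Sum>t\<in>{a..<c}. (y t - ?b t)\<^sup>2 - (y t - u)\<^sup>2)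
        = (\<Sum>k<m. (y (a + k) - ogd_base s B y a k)\<^sup>2 - (y (a + k) - u)\<^sup>2)"
      unfolding c by (subst sum.atLeastLessThan_shift_0) (simp add: lessThan_atLeast0)
    also have "\<dots> \<le> A\<^sup>2 * harm m"
    proof -
      have "(\<Sum>k<m. (y (a + k) - ogd_base s B y a k)\<^sup>2 - (y (a + k) - u)\<^sup>2)
           + real m * (ogd_base s B y a m - u)\<^sup>2 \<le> A\<^sup>2 * harm m"
        by (rule ogd_base_regret) (use assms c in auto)
      moreover have "real m * (ogd_base s B y a m - u)\<^sup>2 \<ge> 0" by simp
      ultimately show ?thesis by linarith
    qed
    \<comment> \<open>\<open>harm k - ln k\<close> decreases in \<open>k\<close> from its value 1 at
      \<open>k = 1\<close>; the library sequence is indexed by \<open>k - 1\<close>.\<close>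
    also have "harm m \<le> ln (real m) + 1"
      using decseqD[OF decseq_harm_diff_ln, of 0 "m - 1"] m by (simp add: harm_def)
    also have "ln (real m) \<le> ln (real n)" using m by simp
    finally show ?thesis by (simp add: mult_left_mono add.commute)
  qed
  ultimately show ?thesis by (simp add: sum_subtractf)
qed

section \<open>From interval regret to dynamic regret\<close>

text \<open>Counts the jumps between the values at \<open>a, ..., c\<close>, both included. For a
  bin \<open>{a..<c}\<close>, \<open>tv a (c - 1)\<close> thus holds the inner jumps and
  \<open>tv a c\<close> also the jump out of the bin.\<close>

definition tv :: "nat \<Rightarrow> nat \<Rightarrow> (nat \<Rightarrow> real) \<Rightarrow> real" where
  "tv a c w = (\<Sum>t\<in>{a..<c}. \<bar>w (Suc t) - w t\<bar>)"

definition fused_lasso :: "nat \<Rightarrow> real \<Rightarrow> (nat \<Rightarrow> real) \<Rightarrow> (nat \<Rightarrow> real) \<Rightarrow> real" where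
  "fused_lasso n \<mu> y w = (\<Sum>t\<in>{1..n}. (y t - w t)\<^sup>2) + \<mu> * tv 1 n w"

definition fused_lasso_min :: "nat \<Rightarrow> real \<Rightarrow> real \<Rightarrow> (nat \<Rightarrow> real) \<Rightarrow> (nat \<Rightarrow> real) \<Rightarrow> bool" where
  "fused_lasso_min n B \<mu> y w \<longleftrightarrow> (\<forall>t\<in>{1..n}. \<bar>w t\<bar> \<le> B) \<and>
     (\<forall>z. (\<forall>t\<in>{1..n}. \<bar>z t\<bar> \<le> B) \<longrightarrow> fused_lasso n \<mu> y w \<le> fused_lasso n \<mu> y z)"

lemma tv_nonneg: "tv a c w \<ge> 0"
  by (simp add: tv_def sum_nonneg)

lemma tv_split: "a \<le> b \<Longrightarrow> b \<le> c \<Longrightarrow> tv a c w = tv a b w + tv b c w"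
  by (simp add: tv_def sum.atLeastLessThan_concat)

text \<open>Sequences are infinite, so coordinates outside \<open>{1..n}\<close> are pinned to 0:
  the box then is compact by Tychonoff's theorem, and the objective does not see the pinned
  coordinates.\<close>

lemma fused_lasso_min_exists:
  assumes "B \<ge> 0"
  shows "\<exists>w. fused_lasso_min n B \<mu> y w"
proof -
  define T where "T = (PiE UNIV (\<lambda>t. if t \<in> {1..n} then {-B..B} else {0}) :: (nat \<Rightarrow> real) set)"
  have "compactin (product_topology (\<lambda>_. euclidean) UNIV) T"
    unfolding T_def by (auto simp: compactin_PiE)
  then have "compact T" by (simp add: euclidean_product_topology)
  moreover have "T \<noteq> {}" unfolding T_def PiE_eq_empty_iff using assms by auto
  moreover have "continuous_on T (fused_lasso n \<mu> y)"
    unfolding fused_lasso_def tv_def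
    by (intro continuous_intros continuous_on_subset[OF continuous_on_product_coordinates]) auto
  ultimately obtain w where w: "w \<in> T" "\<forall>z\<in>T. fused_lasso n \<mu> y w \<le> fused_lasso n \<mu> y z"
    using continuous_attains_inf by blast
  have "fused_lasso n \<mu> y w \<le> fused_lasso n \<mu> y z" if z: "\<forall>t\<in>{1..n}. \<bar>z t\<bar> \<le> B" for z
  proof -
    define z' where "z' = (\<lambda>t. if t \<in> {1..n} then z t else 0)"
    have "z' \<in> T" using z unfolding T_def z'_def by (auto simp: abs_le_iff minus_le_iff)
    moreover have "fused_lasso n \<mu> y z' = fused_lasso n \<mu> y z"
      unfolding fused_lasso_def tv_def z'_def by (intro arg_cong2[of _ _ _ _ "(+)"] arg_cong2[of _ _ _ _ "(*)"] sum.cong) auto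
    ultimately show ?thesis using w(2) by auto
  qed
  moreover have "\<bar>w t\<bar> \<le> B" if "t \<in> {1..n}" for t
  proof -
    have "w t \<in> {-B..B}" using w(1) that unfolding T_def PiE_iff by (metis UNIV_I)
    then show ?thesis by auto
  qed
  ultimately show ?thesis unfolding fused_lasso_min_def by blast
qed

text \<open>First-order optimality under the dilation \<open>w t + \<eta> (w t - u)\<close>, \<open>\<eta> \<down> 0\<close>, of the bin \<open>{a..<c}\<close>.
  Being a dilation away from \<open>u\<close>, it stays in the box only if \<open>u\<close> equals each end of the box that the
  bin touches. The sign \<open>q\<close> is the direction of the jump out of the bin, and \<open>q = 0\<close> for the final bin.\<close>
lemma fused_lasso_min_dilation:
  assumes min: "fused_lasso_min n B \<mu> y w" and "\<mu> \<ge> 0"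
    and bin: "1 \<le> a" "a < c" "c \<le> Suc n"
    and feas: "\<And>t. t \<in> {a..<c} \<Longrightarrow> (w t = B \<longrightarrow> u = B) \<and> (w t = - B \<longrightarrow> u = - B)"
    and exit: "c \<le> n \<Longrightarrow> q * (w c - w (c - 1)) > 0 \<and> \<bar>q\<bar> = 1" "c = Suc n \<Longrightarrow> q = 0"
  shows "2 * (\<Sum>t\<in>{a..<c}. (y t - w t) * (w t - u))
           \<le> \<mu> * (tv a (c - 1) w + \<bar>w a - u\<bar> - q * (w (c - 1) - u))"
proof -
  define z where "z = (\<lambda>\<eta> t. if t \<in> {a..<c} then w t + \<eta> * (w t - u) else w t)"
  define P where "P = (\<Sum>t\<in>{a..<c}. (y t - w t) * (w t - u))"
  define Q where "Q = (\<Sum>t\<in>{a..<c}. (w t - u)\<^sup>2)"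
  define T where "T = tv a (c - 1) w + \<bar>w a - u\<bar> - q * (w (c - 1) - u)"
  have wB: "\<bar>w t\<bar> \<le> B" if "t \<in> {1..n}" for t
    using min that by (auto simp: fused_lasso_min_def)
  \<comment> \<open>A value strictly inside the box has room for small \<eta>; a value at an end of
    the box equals \<open>u\<close> and is fixed by the dilation.\<close>
  have box: "\<forall>\<^sub>F \<eta> in at_right 0. \<forall>t\<in>{a..<c}. \<bar>w t + \<eta> * (w t - u)\<bar> \<le> B"
  proof (intro eventually_ball_finite ballI)
    fix t assume t: "t \<in> {a..<c}"
    then have tn: "t \<in> {1..n}" using bin by auto
    show "\<forall>\<^sub>F \<eta> in at_right 0. \<bar>w t + \<eta> * (w t - u)\<bar> \<le> B"
    proof (cases "\<bar>w t\<bar> = B")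
      case True
      then have "w t = u" using feas[OF t] by (auto simp: abs_if split: if_splits)
      then show ?thesis using wB[OF tn] by simp
    next
      case False
      then have "\<bar>w t\<bar> < B" using wB[OF tn] by simp
      moreover have "((\<lambda>\<eta>. \<bar>w t + \<eta> * (w t - u)\<bar>) \<longlongrightarrow> \<bar>w t + 0 * (w t - u)\<bar>) (at_right 0)"
        by (intro tendsto_intros)
      ultimately have "\<forall>\<^sub>F \<eta> in at_right 0. \<bar>w t + \<eta> * (w t - u)\<bar> < B"
        by (intro order_tendstoD(2)) auto
      then show ?thesis by eventually_elim simp
    qed
  qed auto
  \<comment> \<open>The exit jump is nonzero, so it keeps its sign \<open>q\<close> for small \<eta>
    and its absolute value is linear in \<eta>.\<close>
  have small: "\<forall>\<^sub>F \<eta> in at_right 0. c \<le> n \<longrightarrow> q * (w c - w (c - 1) - \<eta> * (w (c - 1) - u)) > 0"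
  proof (cases "c \<le> n")
    case True
    have "((\<lambda>\<eta>. q * (w c - w (c - 1) - \<eta> * (w (c - 1) - u))) \<longlongrightarrow>
        q * (w c - w (c - 1) - 0 * (w (c - 1) - u))) (at_right 0)"
      by (intro tendsto_intros)
    then have "\<forall>\<^sub>F \<eta> in at_right 0. q * (w c - w (c - 1) - \<eta> * (w (c - 1) - u)) > 0"
      using exit(1)[OF True] by (intro order_tendstoD(1)) auto
    then show ?thesis by eventually_elim simp
  qed auto
  have tvz: "tv 1 n (z \<eta>) \<le> tv 1 n w + \<eta> * T"
    if \<eta>: "\<eta> > 0" and sm: "c \<le> n \<longrightarrow> q * (w c - w (c - 1) - \<eta> * (w (c - 1) - u)) > 0" for \<eta>
  proof -
    \<comment> \<open>\<open>\<tau> t\<close> bounds the growth rate in \<eta> of the jump from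
      \<open>t\<close> to \<open>t + 1\<close>: inner jumps scale by \<open>1 + \<eta>\<close>, the
      entry jump grows at most by the shift of \<open>w a\<close>, and the exit jump changes by a
      signed amount, which is where the saving comes from.\<close>
    define \<tau> where "\<tau> = (\<lambda>t. (if t \<in> {a..<c - 1} then \<bar>w (Suc t) - w t\<bar> else 0)
        + ((if t = a - 1 then \<bar>w a - u\<bar> else 0) + (if t = c - 1 then - (q * (w t - u)) else 0)))"
    have "tv 1 n (z \<eta>) \<le> (\<Sum>t\<in>{1..<n}. \<bar>w (Suc t) - w t\<bar> + \<eta> * \<tau> t)"
      unfolding tv_def
    proof (intro sum_mono)
      fix t assume t: "t \<in> {1..<n}"
      consider "Suc t < a" | "Suc t = a" | "a \<le> t" "Suc t < c" | "Suc t = c" "a \<le> t" | "c \<le> t" by linarith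
      then show "\<bar>z \<eta> (Suc t) - z \<eta> t\<bar> \<le> \<bar>w (Suc t) - w t\<bar> + \<eta> * \<tau> t"
      proof cases
        case 1
        then show ?thesis using bin by (auto simp: z_def \<tau>_def)
      next
        case 2
        then have "z \<eta> (Suc t) - z \<eta> t = w (Suc t) - w t + \<eta> * (w a - u)"
          using bin by (auto simp: z_def)
        moreover have "\<tau> t = \<bar>w a - u\<bar>" using bin 2 by (auto simp: \<tau>_def)
        ultimately show ?thesis
          using \<eta> abs_triangle_ineq[of "w (Suc t) - w t" "\<eta> * (w a - u)"] by (simp add: abs_mult)
      next
        case 3
        then have "\<bar>z \<eta> (Suc t) - z \<eta> t\<bar> = \<bar>(1 + \<eta>) * (w (Suc t) - w t)\<bar>"
          by (auto simp: z_def algebra_simps)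
        moreover have "\<tau> t = \<bar>w (Suc t) - w t\<bar>" using bin t 3 by (auto simp: \<tau>_def)
        ultimately show ?thesis using \<eta> unfolding abs_mult by (simp add: distrib_right)
      next
        case 4
        then have cn: "c \<le> n" "t = c - 1" using t by auto
        have "z \<eta> (Suc t) - z \<eta> t = w c - w (c - 1) - \<eta> * (w (c - 1) - u)"
          using 4 by (auto simp: z_def)
        moreover have "\<tau> t = - (q * (w (c - 1) - u))" using bin t 4 by (auto simp: \<tau>_def)
        moreover have "\<bar>w c - w (c - 1) - \<eta> * (w (c - 1) - u)\<bar> = q * (w c - w (c - 1) - \<eta> * (w (c - 1) - u))"
          "\<bar>w c - w (c - 1)\<bar> = q * (w c - w (c - 1))"
          using sm cn exit(1) by (auto simp: abs_if zero_less_mult_iff split: if_splits)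
        moreover have "q * (w c - w (c - 1) - \<eta> * (w (c - 1) - u))
            = q * (w c - w (c - 1)) + \<eta> * - (q * (w (c - 1) - u))"
          by (simp add: algebra_simps)
        ultimately show ?thesis using 4(1) cn(2) by simp
      next
        case 5
        then show ?thesis using bin by (auto simp: z_def \<tau>_def)
      qed
    qed
    also have "\<dots> = tv 1 n w + \<eta> * (\<Sum>t\<in>{1..<n}. \<tau> t)"
      by (simp add: tv_def sum.distrib sum_distrib_left)
    also have "(\<Sum>t\<in>{1..<n}. \<tau> t) \<le> T"
    proof -
      have "(\<Sum>t\<in>{1..<n}. if t \<in> {a..<c - 1} then \<bar>w (Suc t) - w t\<bar> else 0) = tv a (c - 1) w"
        unfolding tv_def using bin by (subst sum.inter_restrict[symmetric]) (auto intro!: sum.cong)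
      moreover have "(\<Sum>t\<in>{1..<n}. if t = a - 1 then \<bar>w a - u\<bar> else 0) \<le> \<bar>w a - u\<bar>" by simp
      moreover have "(\<Sum>t\<in>{1..<n}. if t = c - 1 then - (q * (w t - u)) else 0) = - (q * (w (c - 1) - u))"
        if "c - 1 \<ge> 1"
        using bin exit(2) that by (auto simp: not_le)
      ultimately show ?thesis unfolding \<tau>_def T_def sum.distrib using bin by (cases "c - 1 \<ge> 1") auto
    qed
    finally show ?thesis using \<eta> by simp
  qed
  have sq: "(\<Sum>t\<in>{1..n}. (y t - z \<eta> t)\<^sup>2) = (\<Sum>t\<in>{1..n}. (y t - w t)\<^sup>2) - 2 * \<eta> * P + \<eta>\<^sup>2 * Q" for \<eta>
  proof -
    have "(\<Sum>t\<in>{1..n}. (y t - z \<eta> t)\<^sup>2) = (\<Sum>t\<in>{1..n}. (y t - w t)\<^sup>2 +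
        (if t \<in> {a..<c} then - 2 * \<eta> * ((y t - w t) * (w t - u)) + \<eta>\<^sup>2 * (w t - u)\<^sup>2 else 0))"
      by (intro sum.cong) (auto simp: z_def power2_eq_square algebra_simps)
    also have "\<dots> = (\<Sum>t\<in>{1..n}. (y t - w t)\<^sup>2) +
        (\<Sum>t\<in>{1..n}. if t \<in> {a..<c} then - 2 * \<eta> * ((y t - w t) * (w t - u)) + \<eta>\<^sup>2 * (w t - u)\<^sup>2 else 0)"
      by (rule sum.distrib)
    also have "(\<Sum>t\<in>{1..n}. if t \<in> {a..<c} then - 2 * \<eta> * ((y t - w t) * (w t - u)) + \<eta>\<^sup>2 * (w t - u)\<^sup>2 else 0)
        = (\<Sum>t\<in>{a..<c}. - 2 * \<eta> * ((y t - w t) * (w t - u)) + \<eta>\<^sup>2 * (w t - u)\<^sup>2)"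
      using bin by (subst sum.inter_restrict[symmetric]) (auto intro!: sum.cong)
    also have "\<dots> = - 2 * \<eta> * P + \<eta>\<^sup>2 * Q"
      by (simp only: P_def Q_def sum.distrib sum_distrib_left)
    finally show ?thesis by simp
  qed
  have "\<forall>\<^sub>F \<eta> in at_right 0. 0 \<le> \<mu> * T - 2 * P + \<eta> * Q"
    using box small eventually_at_right_less[of "0::real"]
  proof eventually_elim
    case (elim \<eta>)
    have "\<forall>t\<in>{1..n}. \<bar>z \<eta> t\<bar> \<le> B"
      using elim(1) wB by (auto simp: z_def)
    then have "fused_lasso n \<mu> y w \<le> fused_lasso n \<mu> y (z \<eta>)"
      using min by (auto simp: fused_lasso_min_def)
    also have "\<dots> \<le> (\<Sum>t\<in>{1..n}. (y t - w t)\<^sup>2) - 2 * \<eta> * P + \<eta>\<^sup>2 * Q + \<mu> * (tv 1 n w + \<eta> * T)"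
      unfolding fused_lasso_def sq using tvz[OF elim(3,2)] \<open>\<mu> \<ge> 0\<close> by (simp add: mult_left_mono)
    finally have "0 \<le> \<eta> * (\<mu> * T - 2 * P + \<eta> * Q)"
      by (simp add: fused_lasso_def algebra_simps power2_eq_square)
    then show ?case using elim(3) by (simp add: zero_le_mult_iff)
  qed
  moreover have "((\<lambda>\<eta>. \<mu> * T - 2 * P + \<eta> * Q) \<longlongrightarrow> \<mu> * T - 2 * P + 0 * Q) (at_right 0)"
    by (intro tendsto_intros)
  ultimately have "0 \<le> \<mu> * T - 2 * P + 0 * Q"
    by (intro tendsto_lowerbound) auto
  then show ?thesis by (simp add: P_def T_def)
qed

text \<open>Touching both ends of the box would force \<open>2 * B \<le> 2 * \<epsilon>\<close>, so
  the bin touches at most one; take that end as \<open>u\<close>, and \<open>w a\<close> if there is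
  none. The last two conclusions serve to show that \<open>u\<close> is not on the exit side of
  \<open>w a\<close>.\<close>

lemma dilation_center_exists:
  fixes w :: "nat \<Rightarrow> real"
  assumes "\<epsilon> < B" "a < c" and bin: "\<And>t. t \<in> {a..<c} \<Longrightarrow> \<bar>w t - w a\<bar> \<le> \<epsilon> \<and> \<bar>w t\<bar> \<le> B"
  obtains u where "\<bar>u\<bar> \<le> B" "\<bar>w a - u\<bar> \<le> \<epsilon>"
    "\<And>t. t \<in> {a..<c} \<Longrightarrow> (w t = B \<longrightarrow> u = B) \<and> (w t = - B \<longrightarrow> u = - B)"
    "w a < u \<Longrightarrow> B \<le> w a + \<epsilon>" "u < w a \<Longrightarrow> w a - \<epsilon> \<le> - B"
proof -
  have a: "\<bar>w a\<bar> \<le> B" "0 \<le> \<epsilon>" using bin[of a] assms(2) by auto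
  have both: False if "t \<in> {a..<c}" "w t = B" "t' \<in> {a..<c}" "w t' = - B" for t t'
    using bin[OF that(1)] bin[OF that(3)] that assms(1) by linarith
  consider (hi) t where "t \<in> {a..<c}" "w t = B" | (lo) t where "t \<in> {a..<c}" "w t = - B"
    | (mid) "\<And>t. t \<in> {a..<c} \<Longrightarrow> w t \<noteq> B \<and> w t \<noteq> - B" by blast
  then show thesis
  proof cases
    case hi
    show thesis
      by (rule that[of B]) (use hi bin[OF hi(1)] a both[OF hi] in \<open>auto simp: abs_le_iff\<close>)
  next
    case lo
    show thesis
      by (rule that[of "- B"]) (use lo bin[OF lo(1)] a both[OF _ _ lo] in \<open>auto simp: abs_le_iff\<close>)
  next
    case mid
    show thesis by (rule that[of "w a"]) (use mid a in auto)
  qed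
qed

text \<open>Expands \<open>(y t - u)\<^sup>2\<close> around \<open>w t\<close>. The cross term is
  left as it is, because optimality of \<open>w\<close> controls it.\<close>

lemma bin_regret_split:
  fixes x y w :: "nat \<Rightarrow> real"
  assumes "\<And>t. t \<in> {a..<c} \<Longrightarrow> \<bar>w t - u\<bar> \<le> 2 * \<epsilon>"
    and "(\<Sum>t\<in>{a..<c}. (y t - x t)\<^sup>2 - (y t - u)\<^sup>2) \<le> L"
  shows "(\<Sum>t\<in>{a..<c}. (y t - x t)\<^sup>2 - (y t - w t)\<^sup>2)
           \<le> L + 4 * \<epsilon>\<^sup>2 * real (c - a) + 2 * (\<Sum>t\<in>{a..<c}. (y t - w t) * (w t - u))"
proof -
  have "(\<Sum>t\<in>{a..<c}. (y t - x t)\<^sup>2 - (y t - w t)\<^sup>2)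
      = (\<Sum>t\<in>{a..<c}. ((y t - x t)\<^sup>2 - (y t - u)\<^sup>2) + 2 * ((y t - w t) * (w t - u)) + (w t - u)\<^sup>2)"
    by (intro sum.cong) (auto simp: power2_eq_square algebra_simps)
  also have "\<dots> = (\<Sum>t\<in>{a..<c}. (y t - x t)\<^sup>2 - (y t - u)\<^sup>2)
      + 2 * (\<Sum>t\<in>{a..<c}. (y t - w t) * (w t - u)) + (\<Sum>t\<in>{a..<c}. (w t - u)\<^sup>2)"
    by (simp only: sum.distrib sum_distrib_left)
  also have "(\<Sum>t\<in>{a..<c}. (w t - u)\<^sup>2) \<le> (\<Sum>t\<in>{a..<c}. 4 * \<epsilon>\<^sup>2)"
  proof (intro sum_mono)
    fix t assume "t \<in> {a..<c}"
    then have "\<bar>w t - u\<bar>\<^sup>2 \<le> (2 * \<epsilon>)\<^sup>2" using assms(1) by (intro power_mono) auto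
    then show "(w t - u)\<^sup>2 \<le> 4 * \<epsilon>\<^sup>2" by (simp add: power_mult_distrib)
  qed
  finally show ?thesis using assms(2) by (simp add: algebra_simps)
qed

text \<open>Peels off the first greedy bin and recurses on the remaining rounds. Only the last bin
  has no exit jump to pay for it; it leaves \<open>2 * L\<close>, one \<open>L\<close> for its
  interval regret and one for the distance of up to \<epsilon> between \<open>w a\<close> and
  \<open>u\<close>.\<close>

lemma fused_lasso_min_regret:
  fixes x y w :: "nat \<Rightarrow> real"
  assumes min: "fused_lasso_min n B (L / \<epsilon>) y w" and \<epsilon>: "0 < \<epsilon>" "\<epsilon> < B" and L: "L \<ge> 0"
    and reg: "\<And>a c u. 1 \<le> a \<Longrightarrow> a < c \<Longrightarrow> c \<le> Suc n \<Longrightarrow> \<bar>u\<bar> \<le> B \<Longrightarrow>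
      (\<Sum>t\<in>{a..<c}. (y t - x t)\<^sup>2 - (y t - u)\<^sup>2) \<le> L"
    and a: "1 \<le> a" "a \<le> n"
  shows "(\<Sum>t\<in>{a..<Suc n}. (y t - x t)\<^sup>2 - (y t - w t)\<^sup>2)
           \<le> L / \<epsilon> * tv a n w + 4 * \<epsilon>\<^sup>2 * real (Suc n - a) + 2 * L"
  using a
proof (induction "n - a" arbitrary: a rule: less_induct)
  case less
  have wB: "\<bar>w t\<bar> \<le> B" if "t \<in> {1..n}" for t
    using min that by (auto simp: fused_lasso_min_def)
  have \<mu>: "L / \<epsilon> \<ge> 0" using L \<epsilon> by simp
  have bin_bound: "(\<Sum>t\<in>{a..<c}. (y t - x t)\<^sup>2 - (y t - w t)\<^sup>2) \<le> L + 4 * \<epsilon>\<^sup>2 * real (c - a)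
        + L / \<epsilon> * (tv a (c - 1) w + \<bar>w a - u\<bar> - q * (w (c - 1) - u))"
    if c: "a < c" "c \<le> Suc n" and bin: "\<And>t. t \<in> {a..<c} \<Longrightarrow> \<bar>w t - w a\<bar> \<le> \<epsilon>"
      and u: "\<bar>u\<bar> \<le> B" "\<bar>w a - u\<bar> \<le> \<epsilon>"
        "\<And>t. t \<in> {a..<c} \<Longrightarrow> (w t = B \<longrightarrow> u = B) \<and> (w t = - B \<longrightarrow> u = - B)"
      and q: "c \<le> n \<Longrightarrow> q * (w c - w (c - 1)) > 0 \<and> \<bar>q\<bar> = 1" "c = Suc n \<Longrightarrow> q = 0" for c u q
  proof -
    have "\<bar>w t - u\<bar> \<le> 2 * \<epsilon>" if "t \<in> {a..<c}" for t
      using bin[OF that] u(2) by linarith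
    then have "(\<Sum>t\<in>{a..<c}. (y t - x t)\<^sup>2 - (y t - w t)\<^sup>2) \<le> L + 4 * \<epsilon>\<^sup>2 * real (c - a)
        + 2 * (\<Sum>t\<in>{a..<c}. (y t - w t) * (w t - u))"
      using reg[OF less.prems(1) c u(1)] by (intro bin_regret_split)
    also have "2 * (\<Sum>t\<in>{a..<c}. (y t - w t) * (w t - u))
        \<le> L / \<epsilon> * (tv a (c - 1) w + \<bar>w a - u\<bar> - q * (w (c - 1) - u))"
      by (rule fused_lasso_min_dilation[OF min \<mu> less.prems(1) c u(3) q])
    finally show ?thesis by simp
  qed
  show ?case
  proof (cases "\<exists>c. a < c \<and> c \<le> n \<and> \<bar>w c - w a\<bar> > \<epsilon>")
    case False
    then have bin: "\<bar>w t - w a\<bar> \<le> \<epsilon>" if "t \<in> {a..<Suc n}" for t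
      using that \<epsilon> by (cases "t = a") (force simp: not_less less_Suc_eq_le)+
    obtain u where u: "\<bar>u\<bar> \<le> B" "\<bar>w a - u\<bar> \<le> \<epsilon>"
        "\<And>t. t \<in> {a..<Suc n} \<Longrightarrow> (w t = B \<longrightarrow> u = B) \<and> (w t = - B \<longrightarrow> u = - B)"
      by (rule dilation_center_exists[of \<epsilon> B a "Suc n" w]) (use \<epsilon> bin wB less.prems in auto)
    have "(\<Sum>t\<in>{a..<Suc n}. (y t - x t)\<^sup>2 - (y t - w t)\<^sup>2) \<le> L + 4 * \<epsilon>\<^sup>2 * real (Suc n - a)
        + L / \<epsilon> * (tv a n w + \<bar>w a - u\<bar>)"
      using bin_bound[of "Suc n" u 0] bin u less.prems by auto
    also have "L / \<epsilon> * (tv a n w + \<bar>w a - u\<bar>) \<le> L / \<epsilon> * (tv a n w + \<epsilon>)"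
      using \<mu> u(2) by (intro mult_left_mono) auto
    also have "\<dots> = L / \<epsilon> * tv a n w + L" using \<epsilon> by (simp add: field_simps)
    finally show ?thesis by simp
  next
    case True
    define c where "c = (LEAST c. a < c \<and> c \<le> n \<and> \<bar>w c - w a\<bar> > \<epsilon>)"
    have c: "a < c" "c \<le> n" and out: "\<bar>w c - w a\<bar> > \<epsilon>"
      using LeastI_ex[OF True] by (auto simp: c_def)
    have bin: "\<bar>w t - w a\<bar> \<le> \<epsilon>" if "t \<in> {a..<c}" for t
      using that \<epsilon> c not_less_Least[of t "\<lambda>c. a < c \<and> c \<le> n \<and> \<bar>w c - w a\<bar> > \<epsilon>"]
      by (cases "t = a") (auto simp: c_def[symmetric])
    obtain u where u: "\<bar>u\<bar> \<le> B" "\<bar>w a - u\<bar> \<le> \<epsilon>"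
        "\<And>t. t \<in> {a..<c} \<Longrightarrow> (w t = B \<longrightarrow> u = B) \<and> (w t = - B \<longrightarrow> u = - B)"
        "w a < u \<Longrightarrow> B \<le> w a + \<epsilon>" "u < w a \<Longrightarrow> w a - \<epsilon> \<le> - B"
      by (rule dilation_center_exists[of \<epsilon> B a c w]) (use \<epsilon> bin wB less.prems c in auto)
    \<comment> \<open>The direction is read off from \<open>w a\<close>, but it is also the sign of
      the last jump: \<open>w (c - 1)\<close> is within \<epsilon> of \<open>w a\<close> and
      \<open>w c\<close> is not.\<close>
    define q :: real where "q = (if w c > w a then 1 else - 1)"
    have wc: "\<bar>w c\<bar> \<le> B" using wB[of c] c less.prems by auto
    have wb: "\<bar>w (c - 1) - w a\<bar> \<le> \<epsilon>" using bin[of "c - 1"] c by auto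
    have q: "q * (w c - w (c - 1)) = \<bar>w c - w (c - 1)\<bar>" "\<bar>w c - w (c - 1)\<bar> > 0" "\<bar>q\<bar> = 1"
      using out wb by (auto simp: q_def)
    \<comment> \<open>\<open>u\<close> never lies on the exit side of \<open>w a\<close>, because a center \<open>u = \<plusminus>B \<noteq> w a\<close> means that the
      bin reaches that end of the box, and leaving it by more than \<open>\<epsilon>\<close> is possible only the other way.\<close>
    have gain: "\<bar>w a - u\<bar> - q * (w (c - 1) - u) \<le> \<bar>w c - w (c - 1)\<bar> - \<epsilon>"
    proof (cases "w c > w a")
      case True
      then have "u \<le> w a" using u(4) out wc by linarith
      moreover have "q = 1" "w c - w a > \<epsilon>" using True out by (auto simp: q_def)
      moreover have "\<bar>w c - w (c - 1)\<bar> = w c - w (c - 1)" using True out wb by linarith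
      ultimately show ?thesis by simp
    next
      case False
      then have "u \<ge> w a" using u(5) out wc by linarith
      moreover have "q = - 1" "w a - w c > \<epsilon>" using False out by (auto simp: q_def)
      moreover have "\<bar>w c - w (c - 1)\<bar> = w (c - 1) - w c" using False out wb by linarith
      ultimately show ?thesis by simp
    qed
    have "(\<Sum>t\<in>{a..<c}. (y t - x t)\<^sup>2 - (y t - w t)\<^sup>2) \<le> L + 4 * \<epsilon>\<^sup>2 * real (c - a)
        + L / \<epsilon> * (tv a (c - 1) w + \<bar>w a - u\<bar> - q * (w (c - 1) - u))"
      by (rule bin_bound) (use c bin u q in auto)
    also have "L / \<epsilon> * (tv a (c - 1) w + \<bar>w a - u\<bar> - q * (w (c - 1) - u)) \<le> L / \<epsilon> * (tv a c w - \<epsilon>)"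
      using gain c by (intro mult_left_mono \<mu>, cases c) (auto simp: tv_def sum.atLeastLessThan_Suc)
    also have "L / \<epsilon> * (tv a c w - \<epsilon>) = L / \<epsilon> * tv a c w - L"
      using \<epsilon> by (simp add: field_simps)
    finally have "(\<Sum>t\<in>{a..<c}. (y t - x t)\<^sup>2 - (y t - w t)\<^sup>2)
        \<le> 4 * \<epsilon>\<^sup>2 * real (c - a) + L / \<epsilon> * tv a c w"
      by simp
    moreover have "(\<Sum>t\<in>{c..<Suc n}. (y t - x t)\<^sup>2 - (y t - w t)\<^sup>2)
        \<le> L / \<epsilon> * tv c n w + 4 * \<epsilon>\<^sup>2 * real (Suc n - c) + 2 * L"
      using less.hyps[of c] c less.prems by auto
    moreover have "(\<Sum>t\<in>{a..<Suc n}. (y t - x t)\<^sup>2 - (y t - w t)\<^sup>2) =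
        (\<Sum>t\<in>{a..<c}. (y t - x t)\<^sup>2 - (y t - w t)\<^sup>2) + (\<Sum>t\<in>{c..<Suc n}. (y t - x t)\<^sup>2 - (y t - w t)\<^sup>2)"
      using c by (intro sum.atLeastLessThan_concat[symmetric]) auto
    moreover have "4 * \<epsilon>\<^sup>2 * real (Suc n - a) = 4 * \<epsilon>\<^sup>2 * real (c - a) + 4 * \<epsilon>\<^sup>2 * real (Suc n - c)"
      using c by (simp add: of_nat_diff algebra_simps)
    moreover have "L / \<epsilon> * tv a n w = L / \<epsilon> * tv a c w + L / \<epsilon> * tv c n w"
      using tv_split[of a c n w] c by (simp add: distrib_left)
    ultimately show ?thesis by linarith
  qed
qed

text \<open>The variation term in the regret against \<open>w\<close> is exactly the penalty of
  \<open>w\<close>, so minimality of \<open>w\<close> trades loss plus penalty of \<open>w\<close>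
  for loss plus penalty of \<open>v\<close>.\<close>

lemma dynamic_regret_of_interval_regret:
  fixes x y v :: "nat \<Rightarrow> real"
  assumes \<epsilon>: "0 < \<epsilon>" "\<epsilon> < B" and L: "L \<ge> 0" and n: "n \<ge> 1"
    and reg: "\<And>a c u. 1 \<le> a \<Longrightarrow> a < c \<Longrightarrow> c \<le> Suc n \<Longrightarrow> \<bar>u\<bar> \<le> B \<Longrightarrow>
      (\<Sum>t\<in>{a..<c}. (y t - x t)\<^sup>2 - (y t - u)\<^sup>2) \<le> L"
    and v: "\<And>t. t \<in> {1..n} \<Longrightarrow> \<bar>v t\<bar> \<le> B"
  shows "(\<Sum>t\<in>{1..n}. (y t - x t)\<^sup>2 - (y t - v t)\<^sup>2) \<le> L / \<epsilon> * tv 1 n v + 4 * \<epsilon>\<^sup>2 * real n + 2 * L"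
proof -
  obtain w where w: "fused_lasso_min n B (L / \<epsilon>) y w"
    using fused_lasso_min_exists[of B] \<epsilon> by fastforce
  have "(\<Sum>t\<in>{1..<Suc n}. (y t - x t)\<^sup>2 - (y t - w t)\<^sup>2)
           \<le> L / \<epsilon> * tv 1 n w + 4 * \<epsilon>\<^sup>2 * real (Suc n - 1) + 2 * L"
    by (rule fused_lasso_min_regret[OF w \<epsilon> L reg]) (use n in auto)
  moreover have "fused_lasso n (L / \<epsilon>) y w \<le> fused_lasso n (L / \<epsilon>) y v"
    using w v by (auto simp: fused_lasso_min_def)
  ultimately show ?thesis
    by (simp add: fused_lasso_def sum_subtractf atLeastLessThanSuc_atLeastAtMost)
qed

text \<open>For \<open>B = 0\<close> the quotient is \<open>0\<close> by division by zero, and the regret vanishes.\<close>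
lemma flh_dynamic_regret:
  assumes s: "\<bar>s\<bar> \<le> B" and A: "A > 0" and \<zeta>: "\<zeta> = 1 / (2 * A\<^sup>2)" and n: "n \<ge> 1"
    and y: "\<And>t. t \<in> {1..n} \<Longrightarrow> B + \<bar>y t\<bar> \<le> A"
    and v: "\<And>t. t \<in> {1..n} \<Longrightarrow> \<bar>v t\<bar> \<le> B"
  shows "(\<Sum>t\<in>{1..n}. (y t - flh_pred s B \<zeta> y t)\<^sup>2 - (y t - v t)\<^sup>2)
    \<le> (18 * A\<^sup>2 + B\<^sup>2) * (1 + ln (real n))
      * (1 + root 3 (real n) * root 3 ((tv 1 n v)\<^sup>2) / root 3 (4 * B\<^sup>2))"
proof (cases "B = 0")
  case True
  have "flh_pred s B \<zeta> y t = v t" if "t \<in> {1..n}" for t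
    using flh_pred_bound[OF s, of t \<zeta> y] v[OF that] that True by auto
  then have "(\<Sum>t\<in>{1..n}. (y t - flh_pred s B \<zeta> y t)\<^sup>2 - (y t - v t)\<^sup>2) = 0" by simp
  then show ?thesis using n True by simp
next
  case False
  then have B: "B > 0" using s by simp
  define L where "L = 3 * A\<^sup>2 * (1 + ln (real n))"
  define C where "C = tv 1 n v"
  \<comment> \<open>\<open>r\<close> is \<epsilon> in units of \<open>B / 2\<close>. The cube root
    balances \<open>C / \<epsilon>\<close> against \<open>n * \<epsilon>\<^sup>2\<close>; the floor
    \<open>1 / sqrt n\<close> keeps \<epsilon> positive and lets the additive \<open>2 * L\<close>
    be absorbed.\<close>
  define r1 where "r1 = root 3 (C / (2 * B * real n))"
  define r where "r = max r1 (1 / sqrt (real n))"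
  have nn: "real n > 0" and ln: "ln (real n) \<ge> 0" using n by auto
  have L: "L \<ge> 0" using ln by (simp add: L_def)
  have C: "C \<ge> 0" by (simp add: C_def tv_nonneg)
  have "C \<le> (\<Sum>t\<in>{1..<n}. 2 * B)"
    unfolding C_def tv_def
  proof (intro sum_mono)
    fix t assume "t \<in> {1..<n}"
    then show "\<bar>v (Suc t) - v t\<bar> \<le> 2 * B" using v[of t] v[of "Suc t"] by auto
  qed
  also have "\<dots> \<le> 2 * B * real n" using B by (simp add: of_nat_diff n)
  finally have "r1 \<le> 1" using B nn by (simp add: r1_def)
  moreover have "1 / sqrt (real n) \<le> 1" using n by simp
  ultimately have r: "0 < r" "r \<le> 1" using nn by (auto simp: r_def less_max_iff_disj)
  have r1: "0 \<le> r1" "r1 ^ 3 = C / (2 * B * real n)" "r1 \<le> r"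
    using B C nn by (auto simp: r1_def r_def)
  define \<epsilon> where "\<epsilon> = B / 2 * r"
  have "B * r \<le> B * 1" using r B by (intro mult_left_mono) auto
  then have \<epsilon>: "0 < \<epsilon>" "\<epsilon> < B" using r B unfolding \<epsilon>_def by auto
  have regret: "(\<Sum>t\<in>{1..n}. (y t - flh_pred s B \<zeta> y t)\<^sup>2 - (y t - v t)\<^sup>2)
      \<le> L / \<epsilon> * C + 4 * \<epsilon>\<^sup>2 * real n + 2 * L"
    unfolding C_def
    by (rule dynamic_regret_of_interval_regret[OF \<epsilon> L n])
      (auto simp: L_def intro!: flh_interval_regret s A \<zeta> y v)
  \<comment> \<open>Common scale of the three terms: \<open>C / \<epsilon> \<le> 4 * N\<close>, the
    quadratic term is \<open>B\<^sup>2 * N\<close>, and \<open>N \<ge> 1\<close> absorbs the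
    constant. In fact \<open>N\<close> is the maximum of 1 and
    \<open>n * r1\<^sup>2\<close>.\<close>
  define N where "N = real n * r\<^sup>2"
  have "C = 2 * B * real n * r1 ^ 3" using r1(2) B nn by simp
  also have "\<dots> \<le> 2 * B * real n * r ^ 3" using r1 B by (intro mult_left_mono power_mono) auto
  also have "\<dots> = 4 * N * \<epsilon>" by (simp add: N_def \<epsilon>_def power2_eq_square power3_eq_cube)
  finally have "C / \<epsilon> \<le> 4 * N" using \<epsilon> by (simp add: divide_le_eq)
  then have "L * (C / \<epsilon>) \<le> L * (4 * N)" using L by (intro mult_left_mono)
  moreover have "4 * \<epsilon>\<^sup>2 * real n = B\<^sup>2 * N" by (simp add: \<epsilon>_def N_def power_mult_distrib power_divide)
  moreover have N1: "N \<ge> 1"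
  proof -
    have "(1 / sqrt (real n))\<^sup>2 \<le> r\<^sup>2" by (intro power_mono) (auto simp: r_def)
    then show ?thesis using nn by (simp add: N_def power_divide field_simps)
  qed
  moreover have "2 * L \<le> 2 * L * N" using N1 L by (simp add: mult_le_cancel_left1)
  ultimately have "(\<Sum>t\<in>{1..n}. (y t - flh_pred s B \<zeta> y t)\<^sup>2 - (y t - v t)\<^sup>2) \<le> (6 * L + B\<^sup>2) * N"
    using regret by (simp add: algebra_simps)
  also have "\<dots> \<le> ((18 * A\<^sup>2 + B\<^sup>2) * (1 + ln (real n))) * N"
    using N1 ln by (intro mult_right_mono) (auto simp: L_def algebra_simps)
  also have "N \<le> 1 + real n * r1\<^sup>2"
  proof (cases "r1 \<le> 1 / sqrt (real n)")
    case True
    then have "N = 1" using nn by (simp add: N_def r_def max_def power_divide)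
    then show ?thesis by simp
  next
    case False
    then show ?thesis by (simp add: N_def r_def max_def)
  qed
  also have "real n * r1\<^sup>2 = root 3 (real n * C\<^sup>2 / (4 * B\<^sup>2))"
  proof (rule real_root_pos_unique[symmetric])
    have "(real n * r1\<^sup>2) ^ 3 = real n ^ 3 * (r1 ^ 3)\<^sup>2"
      by (simp add: power_mult_distrib power_mult[symmetric] mult.commute)
    also have "\<dots> = real n * C\<^sup>2 / (4 * B\<^sup>2)"
      unfolding r1(2) using nn B by (simp add: field_simps power2_eq_square power3_eq_cube)
    finally show "(real n * r1\<^sup>2) ^ 3 = real n * C\<^sup>2 / (4 * B\<^sup>2)" .
  qed auto
  also have "\<dots> = root 3 (real n) * root 3 (C\<^sup>2) / root 3 (4 * B\<^sup>2)"
    by (simp add: real_root_mult real_root_divide)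
  finally show ?thesis using ln unfolding C_def
    by (simp add: mult_left_mono)
qed

text \<open>Hoelder's inequality with exponents 3 and 3/2, proved by summing the tangent line of the
  concave function \<open>s\<close> to the power \<open>2/3\<close> at the mean
  \<open>C / d\<close>. The tangent needs a positive mean, so \<open>C = 0\<close> and
  \<open>d = 0\<close> are treated apart.\<close>

lemma sum_root3_square_le:
  fixes c :: "nat \<Rightarrow> real"
  assumes "\<And>i. i < d \<Longrightarrow> c i \<ge> 0" and "(\<Sum>i<d. c i) \<le> C"
  shows "(\<Sum>i<d. root 3 ((c i)\<^sup>2)) \<le> root 3 (real d) * root 3 (C\<^sup>2)"
proof (cases "C = 0 \<or> d = 0")
  case True
  have "c i = 0" if "i < d" for i
  proof -
    have "C = 0" using True that by auto
    moreover have "c i \<le> (\<Sum>i<d. c i)" using assms(1) that by (intro member_le_sum) auto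
    ultimately show ?thesis using assms that by (metis dual_order.antisym order.trans)
  qed
  then show ?thesis by simp
next
  case False
  then have d: "real d > 0" by simp
  have "C \<ge> 0" using assms by (meson order.trans sum_nonneg lessThan_iff)
  then have C: "C > 0" using False by simp
  define D where "D = root 3 (real d)"
  define E where "E = root 3 C"
  have D: "D > 0" "D ^ 3 = real d" and E: "E > 0" "E ^ 3 = C"
    using d C by (auto simp: D_def E_def)
  have "root 3 ((c i)\<^sup>2) \<le> 2 / 3 * (D / E) * c i + (E / D)\<^sup>2 / 3" if "i < d" for i
  proof -
    define e where "e = root 3 (c i)"
    define z where "z = D / E * e"
    have e: "e \<ge> 0" "e ^ 3 = c i" using assms(1)[OF that] by (auto simp: e_def)
    have "z \<ge> 0" using e D E by (simp add: z_def)
    \<comment> \<open>The product is \<open>2 * z ^ 3 - 3 * z\<^sup>2 + 1\<close>; its double root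
      \<open>z = 1\<close> is the point of tangency.\<close>
    then have "0 \<le> (z - 1)\<^sup>2 * (2 * z + 1)" by simp
    then have "z\<^sup>2 \<le> 2 / 3 * z ^ 3 + 1 / 3" by (simp add: power2_eq_square power3_eq_cube algebra_simps)
    then have "(E / D)\<^sup>2 * z\<^sup>2 \<le> (E / D)\<^sup>2 * (2 / 3 * z ^ 3 + 1 / 3)"
      by (intro mult_left_mono) auto
    moreover have "(E / D)\<^sup>2 * z\<^sup>2 = e\<^sup>2" using D E by (simp add: z_def power_mult_distrib power_divide)
    moreover have "(E / D)\<^sup>2 * z ^ 3 = D / E * c i"
      using D(1) E(1) unfolding e(2)[symmetric] by (simp add: z_def field_simps power2_eq_square power3_eq_cube)
    moreover have "root 3 ((c i)\<^sup>2) = e\<^sup>2" by (simp add: e_def real_root_power)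
    ultimately show ?thesis by (simp add: algebra_simps)
  qed
  then have "(\<Sum>i<d. root 3 ((c i)\<^sup>2)) \<le> (\<Sum>i<d. 2 / 3 * (D / E) * c i + (E / D)\<^sup>2 / 3)"
    by (intro sum_mono) auto
  also have "\<dots> = 2 / 3 * (D / E) * (\<Sum>i<d. c i) + real d * (E / D)\<^sup>2 / 3"
    by (simp add: sum.distrib sum_distrib_left)
  also have "\<dots> \<le> 2 / 3 * (D / E) * C + real d * (E / D)\<^sup>2 / 3"
    using assms(2) D E by (intro add_right_mono mult_left_mono) auto
  also have "\<dots> = D * E\<^sup>2"
    unfolding D(2)[symmetric] E(2)[symmetric] using D(1) E(1) by (simp add: field_simps power2_eq_square power3_eq_cube)
  finally show ?thesis by (simp add: D_def E_def real_root_power)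
qed

section \<open>Reduction to the univariate problem\<close>

lemma norminf_d_le_iff: "B \<ge> 0 \<Longrightarrow> norminf_d d x \<le> B \<longleftrightarrow> (\<forall>i<d. \<bar>x i\<bar> \<le> B)"
  by (auto simp: norminf_d_def)

lemma inner_d_ge:
  assumes "norminf_d d g \<le> G" "G \<ge> 0"
  shows "inner_d d g z \<ge> - (G * norm1_d d z)"
proof -
  have "\<bar>inner_d d g z\<bar> \<le> (\<Sum>i<d. \<bar>g i * z i\<bar>)" unfolding inner_d_def by (rule sum_abs)
  also have "\<dots> \<le> (\<Sum>i<d. G * \<bar>z i\<bar>)"
    using assms norminf_d_le_iff by (intro sum_mono) (auto simp: abs_mult intro!: mult_right_mono)
  finally show ?thesis by (simp add: norm1_d_def sum_distrib_left)
qed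

lemma norm1_d_triangle: "norm1_d d (\<lambda>i. x i - z i) \<le> norm1_d d (\<lambda>i. x i - y i) + norm1_d d (\<lambda>i. y i - z i)"
  unfolding norm1_d_def sum.distrib[symmetric] by (intro sum_mono) auto

lemma dist1_set_le: "y \<in> W \<Longrightarrow> dist1_set d W x \<le> norm1_d d (\<lambda>i. x i - y i)"
  unfolding dist1_set_def
  by (rule cINF_lower) (auto intro!: bdd_belowI2[where m = 0] simp: norm1_d_def sum_nonneg)

lemma dist1_set_lipschitz:
  assumes "W \<noteq> {}"
  shows "dist1_set d W v \<le> dist1_set d W x + norm1_d d (\<lambda>i. v i - x i)"
proof -
  have "dist1_set d W v - norm1_d d (\<lambda>i. v i - x i) \<le> dist1_set d W x"
    unfolding dist1_set_def[of d W x]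
  proof (rule cINF_greatest[OF assms])
    fix y assume "y \<in> W"
    then show "dist1_set d W v - norm1_d d (\<lambda>i. v i - x i) \<le> norm1_d d (\<lambda>i. x i - y i)"
      using dist1_set_le[of y W d v] norm1_d_triangle[of d v y x] by linarith
  qed
  then show ?thesis by simp
qed

text \<open>The distance is 1-Lipschitz in the L1 norm; testing the subgradient inequality at unit
  steps along coordinate \<open>i\<close> in both directions bounds \<open>g i\<close>.\<close>

lemma dist1_subgradient_bound:
  assumes "W \<noteq> {}" "x \<in> vecs d" "i < d"
    and sub: "\<forall>v\<in>vecs d. dist1_set d W v \<ge> dist1_set d W x + inner_d d g (\<lambda>i. v i - x i)"
  shows "\<bar>g i\<bar> \<le> 1"
proof -
  have "g i * \<sigma> \<le> 1" if "\<bar>\<sigma>\<bar> = 1" for \<sigma> :: real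
  proof -
    define v where "v = x(i := x i + \<sigma>)"
    have diff: "v j - x j = (if j = i then \<sigma> else 0)" for j by (simp add: v_def)
    have "v \<in> vecs d" using assms(2,3) by (auto simp: v_def vecs_def)
    then have "inner_d d g (\<lambda>i. v i - x i) \<le> norm1_d d (\<lambda>i. v i - x i)"
      using sub dist1_set_lipschitz[OF assms(1), of d v x] by fastforce
    moreover have "inner_d d g (\<lambda>i. v i - x i) = g i * \<sigma>"
      unfolding inner_d_def diff using assms(3) by (simp add: if_distrib cong: if_cong)
    moreover have "norm1_d d (\<lambda>i. v i - x i) = 1"
      unfolding norm1_d_def diff using assms(3) that by (simp add: if_distrib cong: if_cong)
    ultimately show ?thesis by simp
  qed
  from this[of 1] this[of "- 1"] show ?thesis by auto
qed

text \<open>The supremum dominates its members only once boundedness is known; this comes from the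
  L1 norm, which is continuous in the product topology and dominates the sup norm.\<close>

lemma compact_subset_box:
  assumes "compact W" "W \<subseteq> vecs d" "B = (SUP v\<in>W. norminf_d d v)"
  shows "W \<subseteq> box_d d B"
proof
  fix v assume v: "v \<in> W"
  have "continuous_on W (\<lambda>z. \<Sum>i<d. \<bar>z i\<bar>)"
    by (intro continuous_on_sum continuous_on_rabs continuous_on_subset[OF continuous_on_product_coordinates]) auto
  then have "compact (norm1_d d ` W)"
    using assms(1) by (intro compact_continuous_image) (auto simp: norm1_d_def[abs_def])
  then have "bdd_above (norm1_d d ` W)" by (intro bounded_imp_bdd_above compact_imp_bounded)
  then obtain M where M: "\<And>z. z \<in> W \<Longrightarrow> norm1_d d z \<le> M" by (auto simp: bdd_above_def)
  have "norminf_d d z \<le> norm1_d d z" for z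
    by (subst norminf_d_le_iff) (auto simp: norm1_d_def sum_nonneg intro!: member_le_sum)
  then have "bdd_above (norminf_d d ` W)"
    using M by (intro bdd_aboveI2[where M = M]) (meson order.trans)
  then have "norminf_d d v \<le> B" unfolding assms(3) using v by (intro cSUP_upper)
  then show "v \<in> box_d d B" using v assms(2) by (auto simp: box_d_def)
qed

text \<open>Projecting costs at most \<open>G\<close> times the distance to \<open>W\<close>, by the
  gradient bound at \<open>xh\<close>. The surrogate pays exactly this at \<open>x\<close> and
  nothing at \<open>w\<close>, so strong convexity of \<open>f\<close> and the subgradient
  inequality of the distance, both taken at \<open>x\<close>, give the bound.\<close>

lemma surrogate_round_regret:
  assumes H: "H > 0" and G: "G \<ge> 0" and box: "W \<subseteq> box_d d B" "x \<in> box_d d B"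
    and mem: "xh \<in> W" "w \<in> W"
    and grad: "norminf_d d (Df xh) \<le> G" and sc: "strongly_convex_on_d d H (box_d d B) f Df"
    and proj: "\<forall>v\<in>W. norm1_d d (\<lambda>i. x i - xh i) \<le> norm1_d d (\<lambda>i. x i - v i)"
    and sub: "\<forall>v\<in>vecs d. dist1_set d W v \<ge> dist1_set d W x + inner_d d sg (\<lambda>i. v i - x i)"
    and y: "\<And>i. i < d \<Longrightarrow> y i = x i - (Df x i + G * sg i) / H"
  shows "f xh - f w \<le> H / 2 * (\<Sum>i<d. (y i - x i)\<^sup>2 - (y i - w i)\<^sup>2)"
proof -
  have xw: "xh \<in> box_d d B" "w \<in> box_d d B" using box mem by auto
  have "f x \<ge> f xh + inner_d d (Df xh) (\<lambda>i. x i - xh i) + H / 2 * (norm2_d d (\<lambda>i. x i - xh i))\<^sup>2"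
    using sc xw box(2) unfolding strongly_convex_on_d_def by blast
  moreover have "H / 2 * (norm2_d d (\<lambda>i. x i - xh i))\<^sup>2 \<ge> 0" using H by simp
  ultimately have 1: "f xh \<le> f x + G * norm1_d d (\<lambda>i. x i - xh i)"
    using inner_d_ge[OF grad G, of "\<lambda>i. x i - xh i"] by linarith
  have 2: "f w \<ge> f x + inner_d d (Df x) (\<lambda>i. w i - x i) + H / 2 * (norm2_d d (\<lambda>i. w i - x i))\<^sup>2"
    using sc xw box(2) unfolding strongly_convex_on_d_def by blast
  have "norm1_d d (\<lambda>i. x i - xh i) \<le> dist1_set d W x"
    unfolding dist1_set_def using mem proj by (intro cINF_greatest) auto
  moreover have "dist1_set d W w \<le> 0"
    using dist1_set_le[OF mem(2), of d w] by (simp add: norm1_d_def)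
  moreover have "w \<in> vecs d" using xw by (simp add: box_d_def)
  ultimately have "norm1_d d (\<lambda>i. x i - xh i) \<le> - inner_d d sg (\<lambda>i. w i - x i)"
    using sub by force
  then have "G * norm1_d d (\<lambda>i. x i - xh i) \<le> G * - inner_d d sg (\<lambda>i. w i - x i)"
    using G by (intro mult_left_mono)
  with 1 2 have "f xh - f w \<le> - (G * inner_d d sg (\<lambda>i. w i - x i))
      - inner_d d (Df x) (\<lambda>i. w i - x i) - H / 2 * (norm2_d d (\<lambda>i. w i - x i))\<^sup>2"
    by simp
  also have "(norm2_d d (\<lambda>i. w i - x i))\<^sup>2 = (\<Sum>i<d. (w i - x i)\<^sup>2)"
    by (simp add: norm2_d_def sum_nonneg)
  also have "- (G * inner_d d sg (\<lambda>i. w i - x i)) - inner_d d (Df x) (\<lambda>i. w i - x i) - H / 2 * (\<Sum>i<d. (w i - x i)\<^sup>2)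
      = (\<Sum>i<d. - (G * (sg i * (w i - x i))) - Df x i * (w i - x i) - H / 2 * (w i - x i)\<^sup>2)"
    by (simp add: inner_d_def sum_subtractf sum_negf sum_distrib_left)
  also have "\<dots> = (\<Sum>i<d. H / 2 * ((y i - x i)\<^sup>2 - (y i - w i)\<^sup>2))"
  proof (intro sum.cong refl)
    fix i assume "i \<in> {..<d}"
    \<comment> \<open>\<open>g\<close> is coordinate \<open>i\<close> of the surrogate's
      subgradient; completing the square in \<open>- g * z - H / 2 * z\<^sup>2\<close> with
      \<open>z = w i - x i\<close> yields the squared losses with target
      \<open>x i - g / H\<close>.\<close>
    define g where "g = Df x i + G * sg i"
    have yi: "y i = x i - g / H" using y \<open>i \<in> {..<d}\<close> by (simp add: g_def)
    have "- (G * (sg i * (w i - x i))) - Df x i * (w i - x i) - H / 2 * (w i - x i)\<^sup>2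
        = - g * (w i - x i) - H / 2 * (w i - x i)\<^sup>2"
      by (simp add: g_def algebra_simps)
    also have "\<dots> = H / 2 * ((y i - x i)\<^sup>2 - (y i - w i)\<^sup>2)"
      unfolding yi using H by (simp add: field_simps power2_eq_square)
    finally show "- (G * (sg i * (w i - x i))) - Df x i * (w i - x i) - H / 2 * (w i - x i)\<^sup>2
        = H / 2 * ((y i - x i)\<^sup>2 - (y i - w i)\<^sup>2)" .
  qed
  finally show ?thesis by (simp add: sum_distrib_left)
qed

theorem theorem2:
  fixes H G B :: real
  assumes "H > 0" and "G > 0" and "B \<ge> 0"
  shows "\<exists>(K::real) (p::nat). \<forall>(d::nat) (n::nat) (Cn::real)
           (W :: (nat \<Rightarrow> real) set)
           (f :: nat \<Rightarrow> (nat \<Rightarrow> real) \<Rightarrow> real)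
           (Df :: nat \<Rightarrow> (nat \<Rightarrow> real) \<Rightarrow> (nat \<Rightarrow> real))
           (st :: nat \<Rightarrow> real)
           (x :: nat \<Rightarrow> nat \<Rightarrow> real) (xh :: nat \<Rightarrow> nat \<Rightarrow> real)
           (sg :: nat \<Rightarrow> nat \<Rightarrow> real) (w :: nat \<Rightarrow> nat \<Rightarrow> real).
         d \<ge> 1 \<and> n \<ge> 1 \<and> Cn \<ge> 0
         \<comment> \<open>the decision set W and B = sup of the sup-norm over W\<close>
         \<and> W \<subseteq> vecs d \<and> W \<noteq> {} \<and> compact W \<and> convex_d W
         \<and> B = (SUP v\<in>W. norminf_d d v)
         \<comment> \<open>losses: differentiable, H-strongly convex on D, gradient sup-norm bounded by G\<close>
         \<and> (\<forall>t\<in>{1..n}. (\<forall>z\<in>box_d d B. has_grad_within d (f t) (Df t z) z (box_d d B)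
                                        \<and> norminf_d d (Df t z) \<le> G)
                        \<and> strongly_convex_on_d d H (box_d d B) (f t) (Df t))
         \<comment> \<open>fixed start points of the d univariate FLH-OGD instances\<close>
         \<and> (\<forall>i<d. \<bar>st i\<bar> \<le> B)
         \<comment> \<open>the scheme, rounds 1..n\<close>
         \<and> (\<forall>t\<in>{1..n}.
              x t \<in> vecs d
            \<and> (\<forall>i<d. x t i = flh_pred (st i) B (1 / (2 * (2 * B + 2 * G / H)\<^sup>2))
                                 (\<lambda>\<tau>. x \<tau> i - (Df \<tau> (x \<tau>) i + G * sg \<tau> i) / H) t)
            \<and> xh t \<in> W \<and> (\<forall>v\<in>W. norm1_d d (\<lambda>i. x t i - xh t i) \<le> norm1_d d (\<lambda>i. x t i - v i))
            \<and> sg t \<in> vecs d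
            \<and> (\<forall>v\<in>vecs d. dist1_set d W v \<ge> dist1_set d W (x t) + inner_d d (sg t) (\<lambda>i. v i - x t i)))
         \<comment> \<open>comparator sequence with path length at most Cn\<close>
         \<and> (\<forall>t\<in>{1..n}. w t \<in> W)
         \<and> (\<Sum>t\<in>{2..n}. norm1_d d (\<lambda>i. w t i - w (t - 1) i)) \<le> Cn
       \<longrightarrow> (\<Sum>t\<in>{1..n}. f t (xh t) - f t (w t))
           \<le> K * (1 + ln (real n)) ^ p
               * max (root 3 (real d) * root 3 (real n) * root 3 (Cn\<^sup>2)) (real d)"
proof -
  define A where "A = 2 * B + 2 * G / H"
  \<comment> \<open>For \<open>B = 0\<close> this is 0 and \<open>1 / \<kappa>\<close> is 0 as well,
    so the constant below is valid in that case too.\<close>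
  define \<kappa> where "\<kappa> = root 3 (4 * B\<^sup>2)"
  define M where "M = H / 2 * (18 * A\<^sup>2 + B\<^sup>2)"
  have A: "A > 0" using assms by (simp add: A_def add_nonneg_pos)
  have \<kappa>: "\<kappa> \<ge> 0" by (simp add: \<kappa>_def)
  have M: "M \<ge> 0" using assms by (simp add: M_def)
  show ?thesis
  proof (intro exI[of _ "M * (1 + 1 / \<kappa>)"] exI[of _ 1] allI impI, elim conjE)
    fix d n :: nat and Cn :: real and W :: "(nat \<Rightarrow> real) set" and f Df and st :: "nat \<Rightarrow> real"
      and x xh sg w :: "nat \<Rightarrow> nat \<Rightarrow> real"
    assume d: "d \<ge> 1" and n: "n \<ge> 1" and Cn: "Cn \<ge> 0"
      and W: "W \<subseteq> vecs d" "W \<noteq> {}" "compact W" "B = (SUP v\<in>W. norminf_d d v)"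
      and loss: "\<forall>t\<in>{1..n}. (\<forall>z\<in>box_d d B. has_grad_within d (f t) (Df t z) z (box_d d B)
                                        \<and> norminf_d d (Df t z) \<le> G)
                        \<and> strongly_convex_on_d d H (box_d d B) (f t) (Df t)"
      and st: "\<forall>i<d. \<bar>st i\<bar> \<le> B"
      and scheme: "\<forall>t\<in>{1..n}.
              x t \<in> vecs d
            \<and> (\<forall>i<d. x t i = flh_pred (st i) B (1 / (2 * (2 * B + 2 * G / H)\<^sup>2))
                                 (\<lambda>\<tau>. x \<tau> i - (Df \<tau> (x \<tau>) i + G * sg \<tau> i) / H) t)
            \<and> xh t \<in> W \<and> (\<forall>v\<in>W. norm1_d d (\<lambda>i. x t i - xh t i) \<le> norm1_d d (\<lambda>i. x t i - v i))
            \<and> sg t \<in> vecs d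
            \<and> (\<forall>v\<in>vecs d. dist1_set d W v \<ge> dist1_set d W (x t) + inner_d d (sg t) (\<lambda>i. v i - x t i))"
      and w: "\<forall>t\<in>{1..n}. w t \<in> W"
      and path: "(\<Sum>t\<in>{2..n}. norm1_d d (\<lambda>i. w t i - w (t - 1) i)) \<le> Cn"
    define y where "y = (\<lambda>i \<tau>. x \<tau> i - (Df \<tau> (x \<tau>) i + G * sg \<tau> i) / H)"
    define c where "c = (\<lambda>i. tv 1 n (\<lambda>t. w t i))"
    define \<Lambda> where "\<Lambda> = 1 + ln (real n)"
    define R where "R = root 3 (real d) * root 3 (real n) * root 3 (Cn\<^sup>2)"
    have \<Lambda>: "\<Lambda> \<ge> 0" using n by (simp add: \<Lambda>_def)
    have WB: "W \<subseteq> box_d d B" using W by (intro compact_subset_box)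
    have pred: "x t i = flh_pred (st i) B (1 / (2 * A\<^sup>2)) (y i) t" if "t \<in> {1..n}" "i < d" for t i
      using scheme that unfolding A_def y_def by blast
    have xB: "\<bar>x t i\<bar> \<le> B" if "t \<in> {1..n}" "i < d" for t i
      unfolding pred[OF that] by (rule flh_pred_bound) (use st that in auto)
    have xbox: "x t \<in> box_d d B" if "t \<in> {1..n}" for t
      using scheme xB that assms(3) by (auto simp: box_d_def norminf_d_le_iff)
    have wB: "\<bar>w t i\<bar> \<le> B" if "t \<in> {1..n}" "i < d" for t i
    proof -
      have "w t \<in> box_d d B" using w WB that by blast
      then show ?thesis using that assms(3) by (auto simp: box_d_def norminf_d_le_iff)
    qed
    \<comment> \<open>The losses and the distance term each contribute at most \<open>G\<close> per
      coordinate of the subgradient, which is the choice \<open>2 * G\<close> inside the learning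
      rate.\<close>
    have yA: "B + \<bar>y i t\<bar> \<le> A" if t: "t \<in> {1..n}" and i: "i < d" for t i
    proof -
      have "\<bar>Df t (x t) i\<bar> \<le> G"
        using loss xbox[OF t] t i assms(2) by (auto simp: norminf_d_le_iff)
      moreover have "\<bar>sg t i\<bar> \<le> 1"
        using scheme t i by (intro dist1_subgradient_bound[OF W(2), of "x t" d]) auto
      then have "\<bar>G * sg t i\<bar> \<le> G" using assms(2) by (simp add: abs_mult)
      ultimately have "\<bar>Df t (x t) i + G * sg t i\<bar> \<le> 2 * G" by linarith
      then have "\<bar>(Df t (x t) i + G * sg t i) / H\<bar> \<le> 2 * G / H"
        using assms(1) by (simp add: divide_right_mono)
      then show ?thesis using xB[OF t i] unfolding y_def A_def by linarith
    qed
    have coord: "(\<Sum>t\<in>{1..n}. (y i t - x t i)\<^sup>2 - (y i t - w t i)\<^sup>2)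
        \<le> (18 * A\<^sup>2 + B\<^sup>2) * \<Lambda> * (1 + root 3 (real n) * root 3 ((c i)\<^sup>2) / \<kappa>)" if i: "i < d" for i
    proof -
      have "(\<Sum>t\<in>{1..n}. (y i t - flh_pred (st i) B (1 / (2 * A\<^sup>2)) (y i) t)\<^sup>2 - (y i t - w t i)\<^sup>2)
          \<le> (18 * A\<^sup>2 + B\<^sup>2) * \<Lambda> * (1 + root 3 (real n) * root 3 ((c i)\<^sup>2) / \<kappa>)"
        unfolding \<Lambda>_def c_def \<kappa>_def
        by (rule flh_dynamic_regret) (use st i A n yA wB in auto)
      then show ?thesis using pred i by simp
    qed
    \<comment> \<open>Summed over coordinates, the total variations give the L1 path length, up to a
      shift of the time index by one.\<close>
    have "(\<Sum>i<d. c i) = (\<Sum>t\<in>{1..<n}. norm1_d d (\<lambda>i. w (Suc t) i - w t i))"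
      unfolding c_def tv_def norm1_d_def by (rule sum.swap)
    also have "\<dots> = (\<Sum>t\<in>{Suc 1..<Suc n}. norm1_d d (\<lambda>i. w t i - w (t - 1) i))"
      by (subst sum.atLeast_Suc_lessThan_Suc_shift) simp
    also have "\<dots> \<le> Cn" using path by (simp add: atLeastLessThanSuc_atLeastAtMost numeral_2_eq_2)
    finally have c: "(\<Sum>i<d. root 3 ((c i)\<^sup>2)) \<le> root 3 (real d) * root 3 (Cn\<^sup>2)"
      by (intro sum_root3_square_le) (auto simp: c_def tv_nonneg)
    have "(\<Sum>t\<in>{1..n}. f t (xh t) - f t (w t))
        \<le> (\<Sum>t\<in>{1..n}. H / 2 * (\<Sum>i<d. (y i t - x t i)\<^sup>2 - (y i t - w t i)\<^sup>2))"
    proof (intro sum_mono)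
      fix t assume t: "t \<in> {1..n}"
      then have xh: "xh t \<in> W" using scheme by blast
      then have grad: "norminf_d d (Df t (xh t)) \<le> G" using loss WB t by blast
      show "f t (xh t) - f t (w t) \<le> H / 2 * (\<Sum>i<d. (y i t - x t i)\<^sup>2 - (y i t - w t i)\<^sup>2)"
        by (rule surrogate_round_regret[where W = W and B = B and G = G and Df = "Df t" and sg = "sg t"])
          (use t xh grad assms WB xbox w loss scheme in \<open>auto simp: y_def\<close>)
    qed
    also have "\<dots> = H / 2 * (\<Sum>i<d. \<Sum>t\<in>{1..n}. (y i t - x t i)\<^sup>2 - (y i t - w t i)\<^sup>2)"
      unfolding sum_distrib_left[symmetric] by (subst sum.swap) (rule refl)
    also have "\<dots> \<le> H / 2 * (\<Sum>i<d. (18 * A\<^sup>2 + B\<^sup>2) * \<Lambda> * (1 + root 3 (real n) * root 3 ((c i)\<^sup>2) / \<kappa>))"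
      using assms(1) coord by (intro mult_left_mono sum_mono) auto
    \<comment> \<open>The additive 1 of each coordinate sums to \<open>d\<close>, the second branch
      of the maximum.\<close>
    also have "\<dots> = M * \<Lambda> * (real d + root 3 (real n) * (\<Sum>i<d. root 3 ((c i)\<^sup>2)) / \<kappa>)"
      by (simp add: M_def sum.distrib sum_distrib_left[symmetric] sum_divide_distrib[symmetric] mult.assoc)
    also have "\<dots> \<le> M * \<Lambda> * (real d + root 3 (real n) * (root 3 (real d) * root 3 (Cn\<^sup>2)) / \<kappa>)"
      using M \<Lambda> \<kappa> c by (intro mult_left_mono add_left_mono divide_right_mono) auto
    also have "\<dots> = M * \<Lambda> * (real d + R / \<kappa>)" by (simp add: R_def mult.commute mult.left_commute)
    also have "\<dots> \<le> M * \<Lambda> * (max R (real d) + max R (real d) / \<kappa>)"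
      using M \<Lambda> \<kappa> by (intro mult_left_mono add_mono divide_right_mono) auto
    also have "\<dots> = M * (1 + 1 / \<kappa>) * \<Lambda> ^ 1 * max R (real d)"
      by (simp add: algebra_simps)
    finally show "(\<Sum>t\<in>{1..n}. f t (xh t) - f t (w t))
           \<le> M * (1 + 1 / \<kappa>) * (1 + ln (real n)) ^ 1
               * max (root 3 (real d) * root 3 (real n) * root 3 (Cn\<^sup>2)) (real d)"
      unfolding \<Lambda>_def R_def .
  qed
qed

end
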